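(* Every square Tangle is constructible.
   Context: Fix $r>0$ and let $\mathscr T$ be the tiling of the plane by squares of side length $2r$. Center a circle of radius $r$ at each vertex of $\mathscr T$; circles at adjacent vertices are tangent at the midpoint of the common edge. A link is a quarter of one of these circles whose endpoints are two consecutive tangency points with circles at adjacent vertices. A square Tangle is a smooth (continuously turning tangent) simple closed curve that is the union of finitely many links. Each circle of radius $r$ centered at a vertex of $\mathscr T$ is a square Tangle. The region enclosed is the bounded component of the complement of the curve; a link is convex if, near the link, the enclosed region lies on the same side as the center of its circle, and concave otherwise (always measured with respect to the Tangle containing the link). Operations: a shear insertion replaces a single convex link of a square Tangle by five consecutive links with the same two endpoints which are, in order, concave, convex, convex, convex, concave, provided the result is a square Tangle; a shear reduction replaces five consecutive links which are, in order, convex, concave, concave, concave, convex by a single concave link with the same two endpoints, provided the result is a square Tangle. A square Tangle $\tau$ is constructible if there are square Tangles $\tau_0,\tau_1,\dots,\tau_k=\tau$ such that $\tau_0$ is a circle of radius $r$ centered at a vertex of $\mathscr T$ and each $\tau_i$ is obtained from $\tau_{i-1}$ by a shear insertion or a shear reduction. *)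

theory Defs
  imports "HOL-Complex_Analysis.Complex_Analysis"
begin

text \<open>The plane is \<^typ>\<open>complex\<close>, with coordinates in which the tiling by squares of side
  \<open>2 * r\<close> is axis-parallel and has a vertex at the origin.\<close>

definition tiling_vertices :: "real \<Rightarrow> complex set" where
  "tiling_vertices r = {Complex (2 * r * of_int i) (2 * r * of_int j) | i j. True}"

text \<open>The circle around a vertex \<open>v\<close> touches the circles around the four adjacent vertices at the
  points of direction \<open>k * pi / 2\<close>. The pair \<open>(v, k)\<close>, \<open>k < 4\<close>, stands for the quarter of this
  circle that runs counterclockwise from direction \<open>k * pi / 2\<close> to \<open>(k + 1) * pi / 2\<close>.\<close>

type_synonym link = "complex \<times> nat"

definition links :: "real \<Rightarrow> link set" where
  "links r = tiling_vertices r \<times> {..<4}"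

definition link_path :: "real \<Rightarrow> link \<Rightarrow> real \<Rightarrow> complex" where
  "link_path r l =
     part_circlepath (fst l) r (real (snd l) * pi / 2) ((real (snd l) + 1) * pi / 2)"

definition link_arc :: "real \<Rightarrow> link \<Rightarrow> complex set" where
  "link_arc r l = path_image (link_path r l)"

definition link_ends :: "real \<Rightarrow> link \<Rightarrow> complex set" where
  "link_ends r l = {pathstart (link_path r l), pathfinish (link_path r l)}"

text \<open>A continuously turning tangent means a \<open>C\<^sup>1\<close> parametrization with nowhere
  vanishing derivative whose derivatives also agree where the curve closes up. (The derivatives at
  \<open>0\<close> and \<open>1\<close> are two-sided; this is no restriction, as such a parametrization extends periodically.)\<close>

definition smooth_simple_closed_curve :: "complex set \<Rightarrow> bool" where
  "smooth_simple_closed_curve T \<longleftrightarrow>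
     (\<exists>g. simple_path g \<and> pathfinish g = pathstart g \<and> path_image g = T \<and>
          g C1_differentiable_on {0..1} \<and>
          (\<forall>t\<in>{0..1}. vector_derivative g (at t) \<noteq> 0) \<and>
          vector_derivative g (at 0) = vector_derivative g (at 1))"

definition square_tangle :: "real \<Rightarrow> complex set \<Rightarrow> bool" where
  "square_tangle r T \<longleftrightarrow>
     smooth_simple_closed_curve T \<and>
     (\<exists>L. finite L \<and> L \<subseteq> links r \<and> T = (\<Union>l\<in>L. link_arc r l))"

definition tangle_links :: "real \<Rightarrow> complex set \<Rightarrow> link set" where
  "tangle_links r T = {l \<in> links r. link_arc r l \<subseteq> T}"

text \<open>The condition is imposed at the non-endpoints of the link only, because the curve may leave
  the circle of the link at an endpoint. For a simple closed curve \<^term>\<open>inside T\<close> is the bounded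
  component of the complement.\<close>

definition convex_link :: "real \<Rightarrow> complex set \<Rightarrow> link \<Rightarrow> bool" where
  "convex_link r T l \<longleftrightarrow>
     l \<in> tangle_links r T \<and>
     (\<forall>p \<in> link_arc r l - link_ends r l.
        \<exists>e>0. inside T \<inter> ball p e = ball (fst l) r \<inter> ball p e)"

definition concave_link :: "real \<Rightarrow> complex set \<Rightarrow> link \<Rightarrow> bool" where
  "concave_link r T l \<longleftrightarrow> l \<in> tangle_links r T \<and> \<not> convex_link r T l"

text \<open>Distinct links leading from \<open>a\<close> to \<open>b\<close>, each beginning where the previous one ends. Exactly
  two links of a square Tangle meet at each of its tangency points, so distinct links of a Tangle
  that share an endpoint are consecutive in it.\<close>

definition consecutive_links :: "real \<Rightarrow> complex \<Rightarrow> link list \<Rightarrow> complex \<Rightarrow> bool" where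
  "consecutive_links r a ls b \<longleftrightarrow>
     distinct ls \<and>
     (\<exists>p. p 0 = a \<and> p (length ls) = b \<and>
          (\<forall>i<length ls. link_ends r (ls ! i) = {p i, p (Suc i)}))"

definition replaces_links ::
  "real \<Rightarrow> complex set \<Rightarrow> link set \<Rightarrow> complex set \<Rightarrow> link set \<Rightarrow> bool" where
  "replaces_links r T A T' B \<longleftrightarrow>
     square_tangle r T \<and> square_tangle r T' \<and>
     A \<subseteq> tangle_links r T \<and> B \<subseteq> tangle_links r T' \<and>
     tangle_links r T - A = tangle_links r T' - B"

definition shear_insertion :: "real \<Rightarrow> complex set \<Rightarrow> complex set \<Rightarrow> bool" where
  "shear_insertion r T T' \<longleftrightarrow>
     (\<exists>l l1 l2 l3 l4 l5 a b.
        replaces_links r T {l} T' {l1, l2, l3, l4, l5} \<and>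
        link_ends r l = {a, b} \<and> consecutive_links r a [l1, l2, l3, l4, l5] b \<and>
        convex_link r T l \<and>
        concave_link r T' l1 \<and> convex_link r T' l2 \<and> convex_link r T' l3 \<and>
        convex_link r T' l4 \<and> concave_link r T' l5)"

definition shear_reduction :: "real \<Rightarrow> complex set \<Rightarrow> complex set \<Rightarrow> bool" where
  "shear_reduction r T T' \<longleftrightarrow>
     (\<exists>l l1 l2 l3 l4 l5 a b.
        replaces_links r T {l1, l2, l3, l4, l5} T' {l} \<and>
        link_ends r l = {a, b} \<and> consecutive_links r a [l1, l2, l3, l4, l5] b \<and>
        convex_link r T l1 \<and> concave_link r T l2 \<and> concave_link r T l3 \<and>
        concave_link r T l4 \<and> convex_link r T l5 \<and>
        concave_link r T' l)"

definition constructible :: "real \<Rightarrow> complex set \<Rightarrow> bool" where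
  "constructible r T \<longleftrightarrow>
     (\<exists>(k::nat) \<tau>.
        (\<forall>i\<le>k. square_tangle r (\<tau> i)) \<and>
        (\<exists>v\<in>tiling_vertices r. \<tau> 0 = sphere v r) \<and>
        (\<forall>i<k. shear_insertion r (\<tau> i) (\<tau> (Suc i)) \<or> shear_reduction r (\<tau> i) (\<tau> (Suc i))) \<and>
        \<tau> k = T)"

end

theory Submission
  imports Defs
begin

text \<open>Direct every link so that vertices \<open>(i, j)\<close> of the tiling with \<open>i + j\<close> even are on its left.
  At every tangency point two links then enter and two leave, the smooth turns are exactly the turns from an
  entering to a leaving link, and square Tangles are the simple directed cycles of links. Along
  such a cycle the vertices on one side all have one parity, so a link is convex according
  to the parity of its center.

  A Tangle is shrunk to a circle by undoing shears, each of which removes one vertex from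
  the enclosed region. If a tile contains a concave link and no other, the opposite vertex is
  enclosed and its circle is not touched, so a reduction can be undone there. Otherwise concave links
  come in pairs of opposite links of a tile. Take such a pair with as few links as possible
  between the two on the Tangle. Pairs do not cross, because cutting the Tangle at a pair yields a
  simple closed curve to which the parity statement applies; so there is no concave link between the
  two, only three convex links around one vertex, and an insertion can be undone.\<close>

section \<open>Cells of the grid\<close>

text \<open>The combinatorial part sees the plane only through a predicate \<open>f\<close> with
  \<open>sides\<close>. The Jordan curve theorem supplies one for every directed cycle, also for the
  auxiliary cycles obtained by cutting, because every directed cycle is realized as a smooth simple
  closed curve. The converse, that a Tangle is a directed cycle, is where the derivative conditions
  in the definition of a Tangle are needed. Both operations are one and the same exchange between a
  link \<open>z\<close> and a path \<open>shear z\<close> of five links; the parity of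
  \<open>z\<close> decides which of the two it is. Undoing a reduction thus lengthens the curve
  while it shrinks the enclosed region, so the induction has to count enclosed vertices and not
  links.\<close>

type_synonym cell = "int \<times> int"

text \<open>In units of \<open>r\<close>, the pair \<open>k\<close> stands for the unit square with lower left corner \<open>k\<close>. It contains
  exactly one link, whose center is the corner of the cell with both coordinates even; the opposite corner
  is the center of a tile, and the other two corners are the ends of the link.\<close>

definition floor_half :: "int \<Rightarrow> int" where "floor_half a = a div 2"
definition ceil_half :: "int \<Rightarrow> int" where "ceil_half a = (a + 1) div 2"
text \<open>The interval from \<open>a\<close> to \<open>a + 1\<close> has one even end,
  \<open>2 * ceil_half a\<close>, and one odd end, \<open>2 * floor_half a + 1\<close>.
  \<open>reflect\<close> mirrors it in the odd end and stays in the tile; \<open>across\<close>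
  mirrors it in the even end and stays at the vertex.\<close>

definition reflect :: "int \<Rightarrow> int" where "reflect a = (if even a then a + 1 else a - 1)"
definition across :: "int \<Rightarrow> int" where "across a = (if even a then a - 1 else a + 1)"

lemma reflect_simps [simp]: "reflect (reflect a) = a" "floor_half (reflect a) = floor_half a"
  "reflect a \<noteq> a" "a \<noteq> reflect a"
  "even (ceil_half (reflect a)) \<longleftrightarrow> odd (ceil_half a)"
  unfolding reflect_def floor_half_def ceil_half_def by presburger+

lemma across_simps [simp]: "across (across a) = a" "ceil_half (across a) = ceil_half a"
  "across a \<noteq> a" "a \<noteq> across a"
  "even (floor_half (across a)) \<longleftrightarrow> odd (floor_half a)" "across a \<noteq> reflect a" "reflect a \<noteq> across a"
  "reflect (across a) \<noteq> a" "a \<noteq> reflect (across a)"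
  unfolding reflect_def across_def floor_half_def ceil_half_def by presburger+

lemma floor_half_eq_iff: "floor_half a = floor_half b \<longleftrightarrow> b = a \<or> b = reflect a"
  unfolding reflect_def floor_half_def by presburger

lemma ceil_half_eq_iff: "ceil_half a = ceil_half b \<longleftrightarrow> b = a \<or> b = across a"
  unfolding across_def ceil_half_def by presburger

fun center :: "cell \<Rightarrow> int \<times> int" where "center (a, b) = (2 * ceil_half a, 2 * ceil_half b)"
fun tile_center :: "cell \<Rightarrow> int \<times> int" where "tile_center (a, b) = (2 * floor_half a + 1, 2 * floor_half b + 1)"

text \<open>Links run from the horizontal to the vertical edges of a tile if \<open>even_tile\<close>, and back
  otherwise.\<close>

fun even_tile :: "cell \<Rightarrow> bool" where "even_tile (a, b) \<longleftrightarrow> (even (floor_half a) \<longleftrightarrow>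
  even (floor_half b))"
fun src :: "cell \<Rightarrow> int \<times> int" where
  "src (a, b) = (if even_tile (a, b) then (2 * floor_half a + 1, 2 * ceil_half b)
    else (2 * ceil_half a, 2 * floor_half b + 1))"
fun tgt :: "cell \<Rightarrow> int \<times> int" where
  "tgt (a, b) = (if even_tile (a, b) then (2 * ceil_half a, 2 * floor_half b + 1)
    else (2 * floor_half a + 1, 2 * ceil_half b))"

text \<open>\<open>src_flip\<close>, \<open>tgt_flip\<close> and \<open>opposite\<close> yield the other three links of the tile; \<open>turn\<close>
  yields the next link around the same center.\<close>

fun src_flip :: "cell \<Rightarrow> cell" where "src_flip (a, b) = (if even_tile (a, b) then (reflect a, b)
  else (a, reflect b))"
fun tgt_flip :: "cell \<Rightarrow> cell" where "tgt_flip (a, b) = (if even_tile (a, b) then (a, reflect b)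
  else (reflect a, b))"
fun opposite :: "cell \<Rightarrow> cell" where "opposite (a, b) = (reflect a, reflect b)"
fun turn :: "cell \<Rightarrow> cell" where "turn (a, b) = (if even_tile (a, b) then (across a, b)
  else (a, across b))"
fun vertex_parity :: "int \<times> int \<Rightarrow> bool" where "vertex_parity (x, y) \<longleftrightarrow> even ((x + y) div 2)"

lemma vertex_parity_center [simp]: "vertex_parity (2 * i, 2 * j) \<longleftrightarrow> (even i \<longleftrightarrow> even j)"
proof -
  have "(2 * i + 2 * j) div 2 = i + j" by presburger
  then show ?thesis by simp
qed
declare vertex_parity.simps [simp del]

lemma dbl_neq [simp]: "2 * a + 1 \<noteq> 2 * b" "2 * b \<noteq> 2 * a + (1::int)"
  by presburger+

lemma even_tile_simps [simp]: "even_tile (src_flip k) = even_tile k"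
  "even_tile (tgt_flip k) = even_tile k" "even_tile (opposite k) = even_tile k"
  "even_tile (turn k) \<longleftrightarrow> \<not> even_tile k"
  by (cases k; simp)+

lemma tile_center_flip [simp]: "tile_center (src_flip k) = tile_center k"
  "tile_center (tgt_flip k) = tile_center k" "tile_center (opposite k) = tile_center k"
  by (cases k; simp)+
lemma src_src_flip [simp]: "src (src_flip k) = src k"
  by (cases k; simp)
lemma tgt_tgt_flip [simp]: "tgt (tgt_flip k) = tgt k"
  by (cases k; simp)
lemma flip_flip [simp]: "src_flip (src_flip k) = k" "tgt_flip (tgt_flip k) = k"
  "opposite (opposite k) = k"
  "src_flip (opposite k) = tgt_flip k" "tgt_flip (opposite k) = src_flip k"
    "opposite (src_flip k) = tgt_flip k" "opposite (tgt_flip k) = src_flip k"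
  "src_flip (tgt_flip k) = opposite k" "tgt_flip (src_flip k) = opposite k"
  by (cases k; simp)+
lemma flip_neq [simp]: "src_flip k \<noteq> k" "tgt_flip k \<noteq> k" "opposite k \<noteq> k" "src_flip k \<noteq> tgt_flip k"
  "src_flip k \<noteq> opposite k" "tgt_flip k \<noteq> opposite k"
  by (cases k; simp)+
lemma vertex_parity_flip [simp]: "vertex_parity (center (src_flip k)) \<longleftrightarrow> \<not> vertex_parity (center k)"
  "vertex_parity (center (tgt_flip k)) \<longleftrightarrow> \<not> vertex_parity (center k)"
    "vertex_parity (center (opposite k)) \<longleftrightarrow> vertex_parity (center k)"
  by (cases k; auto)+
lemma turn_simps [simp]: "src (turn k) = tgt k" "center (turn k) = center k"
  "turn (turn (turn (turn k))) = k"
  by (cases k; simp)+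
lemma src_tgt_opposite [simp]: "tgt (opposite k) = tgt (src_flip k)"
  "src (opposite k) = src (tgt_flip k)"
  by (cases k; simp)+
lemma src_neq_tgt [simp]: "src k \<noteq> tgt k" "tgt k \<noteq> src k"
  by (cases k; simp)+
lemma src_turn_neq [simp]: "src (turn (turn k)) \<noteq> src k"
  by (cases k; simp add: floor_half_eq_iff)
lemma src_eq_iff: "src k = src l \<longleftrightarrow> l = k \<or> l = src_flip k"
  by (cases k; cases l; auto simp: floor_half_eq_iff ceil_half_eq_iff)
lemma tgt_eq_iff: "tgt k = tgt l \<longleftrightarrow> l = k \<or> l = tgt_flip k"
  by (cases k; cases l; auto simp: floor_half_eq_iff ceil_half_eq_iff)
text \<open>After \<open>k\<close> a directed path either stays on the circle of \<open>k\<close>,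
  along \<open>turn k\<close>, or passes to the touching circle, whose vertex has the other
  parity.\<close>

lemma tgt_src_iff: "tgt k = src l \<longleftrightarrow> l = turn k \<or> l = turn (tgt_flip k)"
  by (cases k; cases l; auto simp: floor_half_eq_iff ceil_half_eq_iff)
lemma center_eq_iff: "center k = center l \<longleftrightarrow>
  l = k \<or> l = turn k \<or> l = turn (turn k) \<or> l = turn (turn (turn k))"
  by (cases k; cases l; auto simp: ceil_half_eq_iff)
lemmas cell_fun_simps = center.simps tile_center.simps even_tile.simps src.simps tgt.simps src_flip.simps tgt_flip.simps
  opposite.simps turn.simps
declare cell_fun_simps [simp del] split_paired_All [simp del] split_paired_Ex [simp del]

section \<open>Directed cycles of cells\<close>

text \<open>Asking for distinct sources, not just distinct links, makes the curve pass each tangency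
  point at most once.\<close>

definition cell_cycle :: "cell list \<Rightarrow> bool" where
  "cell_cycle ks \<longleftrightarrow> ks \<noteq> [] \<and> distinct (map src ks) \<and> successively (\<lambda>k l. tgt k = src l) ks \<and>
     tgt (last ks) = src (hd ks)"

lemma map_tgt_eq:
  assumes "successively (\<lambda>k l. tgt k = src l) ks" "ks \<noteq> []"
  shows "map tgt ks = tl (map src ks) @ [tgt (last ks)]"
  using assms by (induction ks rule: induct_list012) auto

lemma cell_cycle_tgts:
  assumes "cell_cycle ks"
  shows "map tgt ks = rotate1 (map src ks)"
proof -
  have "map tgt ks = tl (map src ks) @ [src (hd ks)]"
    using assms map_tgt_eq[of ks] by (auto simp: cell_cycle_def)
  then show ?thesis
    using assms by (cases ks) (auto simp: cell_cycle_def)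
qed

lemma cell_cycle_distinct:
  assumes "cell_cycle ks"
  shows "distinct (map tgt ks)" "distinct ks" "set (map tgt ks) = set (map src ks)"
proof -
  show "distinct (map tgt ks)" "set (map tgt ks) = set (map src ks)"
    using assms by (auto simp: cell_cycle_tgts[OF assms] cell_cycle_def simp del: set_map)
  show "distinct ks"
    using assms by (auto simp: cell_cycle_def distinct_map)
qed

text \<open>Each flip shares with \<open>k\<close> its source or its target, so besides
  \<open>k\<close> a cycle can use no link of the tile but \<open>opposite k\<close>.\<close>

lemma cell_cycle_flip_notin:
  assumes "cell_cycle ks" "k \<in> set ks"
  shows "src_flip k \<notin> set ks" "tgt_flip k \<notin> set ks"
proof -
  have "inj_on src (set ks)" "inj_on tgt (set ks)"
    using assms cell_cycle_distinct[OF assms(1)] by (auto simp: cell_cycle_def distinct_map)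
  with assms(2) show "src_flip k \<notin> set ks" "tgt_flip k \<notin> set ks"
    by (metis flip_neq inj_onD src_src_flip, metis flip_neq inj_onD tgt_tgt_flip)
qed

lemma cell_cycle_next:
  assumes "cell_cycle ks" "k \<in> set ks"
  obtains l where "l \<in> set ks" "tgt k = src l"
proof -
  have "tgt k \<in> set (map src ks)"
    using assms(2) cell_cycle_distinct(3)[OF assms(1)] by auto
  then show ?thesis using that by auto
qed

lemma cell_cycle_rotate:
  assumes "cell_cycle (xs @ ys)"
  shows "cell_cycle (ys @ xs)"
  using assms by (cases "xs = []"; cases "ys = []")
    (auto simp: cell_cycle_def successively_append_iff)

lemma successively_invariant:
  assumes "successively R ks" "\<And>k l. k \<in> set ks \<Longrightarrow> l \<in> set ks \<Longrightarrow> R k l \<Longrightarrow> g l = g k" "k \<in> set ks"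
  shows "g k = g (hd ks)"
  using assms
proof (induction ks arbitrary: k rule: induct_list012)
  case (3 x y zs)
  have "g l = g y" if "l \<in> set (y # zs)" for l
    using "3.IH"(2)[of l] "3.prems" that by auto
  moreover have "g y = g x" using "3.prems" by auto
  ultimately show ?case using "3.prems"(3) by auto
qed auto

text \<open>Abstract form of the Jordan curve theorem for a cycle \<open>K\<close>: the center of a link and the center
  of its tile are separated by the curve exactly if the link belongs to the curve.\<close>

definition sides :: "cell set \<Rightarrow> (int \<times> int \<Rightarrow> bool) \<Rightarrow> bool" where
  "sides K f \<longleftrightarrow> (\<forall>k. (f (center k) \<longleftrightarrow> f (tile_center k)) \<longleftrightarrow> k \<notin> K)"

lemma sidesD:
  assumes "sides K f"
  shows "k \<in> K \<Longrightarrow> f (tile_center k) \<longleftrightarrow> \<not> f (center k)" "k \<notin> K \<Longrightarrow> f (tile_center k) \<longleftrightarrow> f (center k)"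
  using assms unfolding sides_def by blast+

text \<open>If \<open>l\<close> stays on the circle of \<open>k\<close>, nothing changes. Otherwise
  its center is that of \<open>tgt_flip k\<close>. The used link \<open>k\<close> separates its
  center from the tile center and the free link \<open>tgt_flip k\<close> does not, so side and
  parity change together.\<close>

lemma sides_step:
  assumes "sides K f" "k \<in> K" "tgt_flip k \<notin> K" "tgt k = src l"
  shows "(f (center l) \<longleftrightarrow> vertex_parity (center l)) \<longleftrightarrow> (f (center k) \<longleftrightarrow> vertex_parity (center k))"
proof -
  have "f (center (tgt_flip k)) \<longleftrightarrow> \<not> f (center k)"
    using sidesD(1)[OF assms(1,2)] sidesD(2)[OF assms(1,3)] by simp
  then show ?thesis using assms(4) by (auto simp: tgt_src_iff)
qed

lemma sides_parity:
  assumes "cell_cycle ks" "sides (set ks) f"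
  obtains \<sigma> where "\<And>k. k \<in> set ks \<Longrightarrow> f (center k) \<longleftrightarrow> (vertex_parity (center k) \<longleftrightarrow> \<sigma>)"
proof
  fix k assume k: "k \<in> set ks"
  have "(f (center k) \<longleftrightarrow> vertex_parity (center k)) = (f (center (hd ks)) \<longleftrightarrow>
    vertex_parity (center (hd ks)))"
    by (rule successively_invariant[where g = "\<lambda>k. f (center k) \<longleftrightarrow> vertex_parity (center k)"
      and R = "\<lambda>k l. tgt k = src l"])
      (use assms k sides_step cell_cycle_flip_notin in \<open>auto simp: cell_cycle_def\<close>)
  then show "f (center k) \<longleftrightarrow> (vertex_parity (center k) \<longleftrightarrow> (f (center (hd ks)) \<longleftrightarrow>
    vertex_parity (center (hd ks))))"
    by blast
qed

text \<open>The detour from \<open>src z\<close> to \<open>tgt z\<close> via the opposite vertex of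
  the tile: the flips lie in the tile of \<open>z\<close>, and the three links between them are the
  circle around that vertex without the quarter \<open>opposite z\<close>.\<close>

definition shear :: "cell \<Rightarrow> cell list" where
  "shear z = [src_flip z, turn (opposite z), turn (turn (opposite z)), turn (turn (turn (opposite z))), tgt_flip z]"

lemma tgt_turn3: "tgt (turn (turn (turn k))) = src k"
  by (metis turn_simps(1,3))

lemma ball_center_eq:
  "(\<forall>k. center k = center w \<longrightarrow> P k) \<longleftrightarrow> P w \<and> P (turn w) \<and> P (turn (turn w)) \<and>
    P (turn (turn (turn w)))"
proof -
  have "center k = center w \<longleftrightarrow> k \<in> {w, turn w, turn (turn w), turn (turn (turn w))}" for k
    using center_eq_iff[of w k] by auto
  then show ?thesis by (simp only:) blast
qed

text \<open>The nodes that the detour adds are the four tangency points on the circle around the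
  opposite vertex, each the source of one of its links. The exchange succeeds exactly if the cycle
  avoids them.\<close>

lemma cell_cycle_shear_iff:
  "cell_cycle (xs @ shear z) \<longleftrightarrow> cell_cycle (xs @ [z]) \<and>
     (\<forall>k. center k = center (opposite z) \<longrightarrow> src k \<notin> set (map src (xs @ [z])))"
proof -
  let ?R = "\<lambda>k l. tgt k = src l"
  define w where "w = opposite z"
  define n1 where "n1 = turn w"
  define n2 where "n2 = turn n1"
  define n3 where "n3 = turn n2"
  have src: "src n1 = tgt (src_flip z)" "src n2 = tgt n1" "src n3 = tgt n2"
    "tgt n3 = src (tgt_flip z)"
    "src w = src (tgt_flip z)"
    by (auto simp: w_def n1_def n2_def n3_def tgt_turn3)
  have "src n1 \<noteq> src w" "src n2 \<noteq> src n1" "src n3 \<noteq> src n2" "src w \<noteq> src n3"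
    using src_neq_tgt[of w] src_neq_tgt[of n1] src_neq_tgt[of n2] src_neq_tgt[of n3]
    by (simp_all add: n1_def n2_def n3_def tgt_turn3)
  moreover have "src n2 \<noteq> src w" "src n3 \<noteq> src n1"
    using src_turn_neq[of w] src_turn_neq[of n1] by (simp_all only: n1_def n2_def n3_def) simp_all
  ultimately have dist: "distinct [src w, src n1, src n2, src n3]"
    by auto
  have shear: "shear z = [src_flip z, n1, n2, n3, tgt_flip z]"
    by (simp add: shear_def w_def n1_def n2_def n3_def)
  have 1: "successively ?R (xs @ shear z) \<longleftrightarrow> successively ?R (xs @ [z])"
    by (simp add: successively_append_iff shear src)
  have 2: "tgt (last (xs @ shear z)) = src (hd (xs @ shear z)) \<longleftrightarrow>
    tgt (last (xs @ [z])) = src (hd (xs @ [z]))"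
    by (cases xs) (simp_all add: shear)
  have 3: "map src (xs @ shear z) = map src xs @ [src z, src n1, src n2, src n3, src w]"
    by (simp add: shear src)
  have 4: "(\<forall>k. center k = center (opposite z) \<longrightarrow> src k \<notin> set (map src (xs @ [z]))) \<longleftrightarrow>
     (\<forall>x\<in>{src w, src n1, src n2, src n3}. x \<noteq> src z \<and> x \<notin> set (map src xs))"
    by (simp only: ball_center_eq flip: w_def n1_def n2_def n3_def) auto
  have 5: "distinct (map src xs @ [src z, src n1, src n2, src n3, src w]) \<longleftrightarrow>
     distinct (map src (xs @ [z])) \<and> (\<forall>x\<in>{src w, src n1, src n2, src n3}. x \<noteq> src z \<and>
       x \<notin> set (map src xs))"
    using dist unfolding map_append list.map(1,2) by auto
  show ?thesis
    unfolding cell_cycle_def 1 2 3 4 5 by auto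
qed

text \<open>Cut at the pair \<open>D\<close>, \<open>opposite D\<close> and close \<open>P\<close> up by \<open>src_flip D\<close>. The links of \<open>Q\<close> all lie on
  one side of this cycle, which contradicts the parities of \<open>B\<close> and \<open>src_flip D\<close>.\<close>

lemma noncrossing:
  assumes ex: "\<And>ks. cell_cycle ks \<Longrightarrow> \<exists>f. sides (set ks) f"
    and cyc: "cell_cycle (P @ D # Q @ [opposite D])"
    and B: "B \<in> set P" "opposite B \<in> set Q" "vertex_parity (center B) = vertex_parity (center D)"
  shows False
proof -
  let ?ks = "P @ D # Q @ [opposite D]"
  let ?p = "P @ [src_flip D]"
  have "P \<noteq> []" using B by auto
  \<comment> \<open>\<open>src_flip D\<close> starts at \<open>src D\<close>, where \<open>P\<close>
    ends, and ends at \<open>tgt (opposite D)\<close>, where \<open>P\<close> begins.\<close>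
  have p: "cell_cycle ?p"
    using cyc \<open>P \<noteq> []\<close> by (auto simp: cell_cycle_def successively_append_iff successively_Cons)
  then obtain f where f: "sides (set ?p) f" using ex by blast
  obtain \<sigma> where \<sigma>: "\<And>k. k \<in> set ?p \<Longrightarrow> f (center k) \<longleftrightarrow> (vertex_parity (center k) \<longleftrightarrow> \<sigma>)"
    using sides_parity[OF p f] by blast
  have free: "k \<notin> set ?p" "tgt_flip k \<notin> set ?p" if "k \<in> set (D # Q)" for k
  proof -
    have "k \<notin> set P" "tgt k \<notin> tgt ` set P" "tgt k \<noteq> tgt (opposite D)"
      using that cell_cycle_distinct(1,2)[OF cyc] by (auto, metis imageI)
    moreover have "k \<noteq> src_flip D"
      using cell_cycle_flip_notin(1)[OF cyc, of D] that by auto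
    ultimately show "k \<notin> set ?p" "tgt_flip k \<notin> set ?p"
      by (auto dest: arg_cong[where f = tgt] imageI[of _ _ tgt])
  qed
  \<comment> \<open>The two tile centers are joined through the center of \<open>l\<close>, and only
    links off the cycle are crossed. When the circle changes at \<open>l\<close>, one of these is
    \<open>tgt_flip k\<close>, which is why it has to be free as well.\<close>
  have step: "f (tile_center l) = f (tile_center k)" if "k \<in> set (D # Q)" "l \<in> set (D # Q)"
    "tgt k = src l" for k l
    using that(3) sidesD(2)[OF f free(1)[OF that(1)]] sidesD(2)[OF f free(2)[OF that(1)]]
      sidesD(2)[OF f free(1)[OF that(2)]]
    by (auto simp: tgt_src_iff)
  have "successively (\<lambda>k l. tgt k = src l) (D # Q)"
    using cyc by (auto simp: cell_cycle_def successively_append_iff successively_Cons)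
  \<comment> \<open>Links of one tile share the tile center, so this compares the tiles of
    \<open>B\<close> and \<open>src_flip D\<close>, two links of the cut cycle with different
    parities.\<close>
  from successively_invariant[where g = "\<lambda>k. f (tile_center k)", OF this step] B(2)
  have "f (tile_center B) = f (tile_center D)" by fastforce
  moreover have "f (tile_center B) \<longleftrightarrow> \<not> f (center B)" "f (tile_center (src_flip D)) \<longleftrightarrow>
    \<not> f (center (src_flip D))"
    using B(1) by (intro sidesD(1)[OF f]; simp)+
  moreover have "f (center B) \<longleftrightarrow> (vertex_parity (center B) \<longleftrightarrow> \<sigma>)" "f (center (src_flip D)) \<longleftrightarrow>
    (vertex_parity (center (src_flip D)) \<longleftrightarrow> \<sigma>)"
    using B(1) by (intro \<sigma>; simp)+
  ultimately show False using B(3) by auto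
qed

text \<open>Parity other than \<open>\<sigma>\<close> stands for concave, and \<open>mates\<close>
  is the situation in which no reduction can be undone. The pairs \<open>k\<close>,
  \<open>opposite k\<close> are like noncrossing chords of the cycle; an innermost chord cuts off a
  leaf that surrounds a single vertex.\<close>

lemma leaf_exists:
  assumes ex: "\<And>ks. cell_cycle ks \<Longrightarrow> \<exists>f. sides (set ks) f"
    and cyc: "cell_cycle ks"
    and D: "D \<in> set ks" "vertex_parity (center D) \<longleftrightarrow> \<not> \<sigma>"
    and mates: "\<And>k. k \<in> set ks \<Longrightarrow> vertex_parity (center k) \<longleftrightarrow> \<not> \<sigma> \<Longrightarrow> opposite k \<in> set ks"
  obtains xs z where "cell_cycle (xs @ shear z)" "set (xs @ shear z) = set ks"
    "vertex_parity (center z) \<longleftrightarrow> \<sigma>"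
proof -
  \<comment> \<open>The cycle is rotated so that \<open>opposite D\<close> comes last;
    \<open>P\<close> is then the stretch that leads from \<open>opposite D\<close> to
    \<open>D\<close>.\<close>
  define S where "S P \<longleftrightarrow> (\<exists>D Q. cell_cycle (P @ D # Q @ [opposite D]) \<and>
    set (P @ D # Q @ [opposite D]) = set ks \<and>
    (vertex_parity (center D) \<longleftrightarrow> \<not> \<sigma>))" for P
  have "\<exists>P. S P"
  proof -
    obtain xs ys where ks: "ks = xs @ opposite D # ys" using mates[OF D] by (meson split_list)
    then have "D \<in> set (ys @ xs)" using D(1) by (metis Un_iff flip_neq(3) set_ConsD set_append)
    then obtain P Q where PQ: "ys @ xs = P @ D # Q" by (meson split_list)
    have "cell_cycle ((opposite D # ys) @ xs)" using cyc ks cell_cycle_rotate by blast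
    then have "cell_cycle ((ys @ xs) @ [opposite D])" using cell_cycle_rotate[of "[opposite D]"
      "ys @ xs"] by simp
    moreover have "set ((ys @ xs) @ [opposite D]) = set ks" using ks by auto
    ultimately have "S P" using D(2) unfolding S_def PQ by auto
    then show ?thesis ..
  qed
  then obtain P where P: "S P" and min: "\<And>P'. S P' \<Longrightarrow> length P \<le> length P'"
    using exists_least_iff[of "\<lambda>n. \<exists>P. S P \<and> length P = n"] by (metis leI)
  obtain D Q where cyc': "cell_cycle (P @ D # Q @ [opposite D])" and set': "set (P @ D # Q @ [opposite D]) = set ks"
    and D': "vertex_parity (center D) \<longleftrightarrow> \<not> \<sigma>"
    using P unfolding S_def by blast
  note dist = cell_cycle_distinct(2)[OF cyc']
  have convex: "vertex_parity (center k) \<longleftrightarrow> \<sigma>" if kP: "k \<in> set P" for k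
  proof (rule ccontr)
    assume k: "\<not> (vertex_parity (center k) \<longleftrightarrow> \<sigma>)"
    obtain P1 P2 where P12: "P = P1 @ k # P2" using kP by (meson split_list)
    have "opposite k \<in> set ks" using mates[of k] kP k set' by auto
    \<comment> \<open>A mate inside \<open>P\<close> bounds a shorter stretch, \<open>Y\<close> or
      \<open>X\<close>, against minimality; a mate in \<open>Q\<close> crosses the pair; the other
      cases contradict distinctness.\<close>
    then consider "opposite k \<in> set P1" | "opposite k \<in> set P2" | "opposite k \<in> set Q" | "opposite k = D" | "opposite k = opposite D" | "opposite k = k"
      unfolding set'[symmetric] P12 by auto
    then show False
    proof cases
      case 1
      then obtain X Y where XY: "P1 = X @ opposite k # Y" by (meson split_list)
      have "cell_cycle ((Y @ k # P2 @ D # Q @ [opposite D]) @ (X @ [opposite k]))"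
        by (rule cell_cycle_rotate) (use cyc' in \<open>simp add: P12 XY\<close>)
      moreover have "set ((Y @ k # P2 @ D # Q @ [opposite D]) @ (X @ [opposite k])) = set ks"
        unfolding set'[symmetric] P12 XY by auto
      ultimately have "S Y"
        using k unfolding S_def by (intro exI[of _ k] exI[of _ "P2 @ D # Q @ [opposite D] @ X"]) auto
      then show False using min[of Y] by (simp add: P12 XY)
    next
      case 2
      then obtain X Y where XY: "P2 = X @ opposite k # Y" by (meson split_list)
      have "cell_cycle ((X @ opposite k # Y @ D # Q @ [opposite D]) @ (P1 @ [k]))"
        by (rule cell_cycle_rotate) (use cyc' in \<open>simp add: P12 XY\<close>)
      moreover have "set ((X @ opposite k # Y @ D # Q @ [opposite D]) @ (P1 @ [k])) = set ks"
        unfolding set'[symmetric] P12 XY by auto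
      ultimately have "S X"
        using k unfolding S_def by (intro exI[of _ "opposite k"] exI[of _ "Y @ D # Q @ [opposite D] @ P1"]) auto
      then show False using min[of X] by (simp add: P12 XY)
    next
      case 3
      then show False using noncrossing[OF ex cyc' kP] k D' by auto
    next
      case 4
      then have "k = opposite D" by auto
      then show False using dist kP by auto
    next
      case 5
      then have "k = D" by (metis flip_flip(3))
      then show False using dist kP by auto
    qed auto
  qed
  have "P \<noteq> []"
    using cyc' src_neq_tgt(1)[of "src_flip D"] by (auto simp: cell_cycle_def)
  \<comment> \<open>\<open>P\<close> will turn out to be the circle around \<open>center C\<close>
    without \<open>C\<close>. The shear to be undone is that of \<open>opposite C\<close>, whose
    flips are \<open>opposite D\<close> and \<open>D\<close>.\<close>
  define C where "C = src_flip D"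
  have C: "src C = src D" "center C \<noteq> center D" "vertex_parity (center C) \<longleftrightarrow> \<sigma>"
    "opposite D = tgt_flip C" "opposite C = tgt_flip D"
    "src_flip C = D" "tgt C = tgt (opposite D)"
    using D' by (auto simp: C_def dest: arg_cong[where f = vertex_parity])
  have hdP: "hd P = turn C"
  proof -
    have "tgt (opposite D) = src (hd P)" using cyc' \<open>P \<noteq> []\<close> by (auto simp: cell_cycle_def)
    then have "hd P = turn C \<or> hd P = turn (tgt_flip C)"
      by (metis C(7) tgt_src_iff)
    then show ?thesis
      using convex[of "hd P"] \<open>P \<noteq> []\<close> C(3) by auto
  qed
  \<comment> \<open>Passing to another circle would change the parity, which is
    \<open>\<sigma>\<close> all along \<open>P\<close>.\<close>
  have succ: "l = turn k" if "k \<in> set P" "l \<in> set P" "tgt k = src l" for k l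
    using that(3) convex[OF that(1)] convex[OF that(2)] unfolding tgt_src_iff by auto
  have chain: "successively (\<lambda>k l. l = turn k) P"
    using cyc' succ by (auto simp: cell_cycle_def successively_append_iff intro: successively_mono)
  have last: "tgt (last P) = src C"
    using cyc' \<open>P \<noteq> []\<close> C(1) by (auto simp: cell_cycle_def successively_append_iff)
  have C_notin: "C \<notin> set P"
    using cyc' C(1) by (auto simp: cell_cycle_def image_iff)
  have ne: "tgt (turn C) \<noteq> src C" "tgt (turn (turn C)) \<noteq> src C"
    by (metis turn_simps(1) src_turn_neq, metis turn_simps(1,3) src_neq_tgt(1) tgt_turn3)
  \<comment> \<open>\<open>P\<close> has to end at \<open>src C\<close>: one or two turns do not
    reach it, and a fourth link would be \<open>C\<close> itself, whose source is taken by
    \<open>D\<close>.\<close>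
  have P_eq: "P = [turn C, turn (turn C), turn (turn (turn C))]"
  proof (cases P)
    case (Cons a P1)
    note 1 = this
    then have a: "a = turn C" using hdP by simp
    then obtain b P2 where 2: "P1 = b # P2" using 1 last ne by (cases P1) auto
    then have b: "b = turn (turn C)" using chain 1 a by simp
    then obtain c P3 where 3: "P2 = c # P3" using 1 2 last ne by (cases P2) auto
    then have c: "c = turn (turn (turn C))" using chain 1 2 b by simp
    have "P3 = []"
    proof (rule ccontr)
      assume "P3 \<noteq> []"
      then have "hd P3 = C" "hd P3 \<in> set P" using chain 1 2 3 c by (auto simp: successively_Cons)
      then show False using C_notin by simp
    qed
    then show ?thesis using 1 2 3 a b c by simp
  qed (use \<open>P \<noteq> []\<close> in simp)
  have eq: "Q @ [opposite D] @ P @ [D] = Q @ shear (opposite C)"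
    unfolding P_eq shear_def using C(4,6) by simp
  have "cell_cycle ((Q @ [opposite D]) @ (P @ [D]))"
    by (rule cell_cycle_rotate) (use cyc' in simp)
  then have "cell_cycle (Q @ shear (opposite C))" using eq by simp
  moreover have "set (Q @ shear (opposite C)) = set ks"
    unfolding set'[symmetric] eq[symmetric] by auto
  ultimately show thesis using that[of Q "opposite C"] C(3) by auto
qed

section \<open>Cells in the plane and the two sides of a curve\<close>

definition grid_point :: "real \<Rightarrow> int \<times> int \<Rightarrow> complex" where
  "grid_point r p = Complex (r * of_int (fst p)) (r * of_int (snd p))"

text \<open>Within each cell, points have coordinates \<open>u, v\<close> in the unit square, measured from the center
  of the link, which becomes the quarter circle \<open>u\<^sup>2 + v\<^sup>2 = 1\<close>.\<close>

definition coord :: "int \<Rightarrow> real \<Rightarrow> real" where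
  "coord a u = (if even a then of_int a + u else of_int a + 1 - u)"

definition cell_point :: "real \<Rightarrow> cell \<Rightarrow> real \<Rightarrow> real \<Rightarrow> complex" where
  "cell_point r k u v = Complex (r * coord (fst k) u) (r * coord (snd k) v)"

definition arc_of :: "real \<Rightarrow> cell \<Rightarrow> complex set" where
  "arc_of r k = {cell_point r k u v |u v. 0 \<le> u \<and> 0 \<le> v \<and> u\<^sup>2 + v\<^sup>2 = 1}"

definition tangle_of :: "real \<Rightarrow> cell set \<Rightarrow> complex set" where
  "tangle_of r K = (\<Union>k\<in>K. arc_of r k)"

lemma coord_ends: "coord a 0 = of_int (2 * ceil_half a)" "coord a 1 = of_int (2 * floor_half a + 1)"
  by (auto simp: coord_def ceil_half_def floor_half_def elim!: evenE oddE)

lemma cell_point_ends: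
  "cell_point r k 0 0 = grid_point r (center k)" "cell_point r k 1 1 = grid_point r (tile_center k)"
  "even_tile k \<Longrightarrow> cell_point r k 1 0 = grid_point r (src k)" "even_tile k \<Longrightarrow>
    cell_point r k 0 1 = grid_point r (tgt k)"
  "\<not> even_tile k \<Longrightarrow> cell_point r k 0 1 = grid_point r (src k)" "\<not> even_tile k \<Longrightarrow>
    cell_point r k 1 0 = grid_point r (tgt k)"
  by (cases k; auto simp: cell_point_def grid_point_def coord_ends cell_fun_simps)+

text \<open>\<open>u\<close> is the distance to the nearest even integer, whichever interval the
  point is assigned to. Two different intervals share at most an end, the even one at
  \<open>u = 0\<close> or the odd one at \<open>u = 1\<close>.\<close>

lemma coord_eqD:
  assumes "coord a u = coord b v" "0 \<le> u" "u \<le> 1" "0 \<le> v" "v \<le> 1"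
  shows "u = v" "b = a \<or> u = 0 \<and> b = across a \<or> u = 1 \<and> b = reflect a"
proof -
  define n where "n = b - a"
  have b: "b = a + n" by (simp add: n_def)
  have "-1 \<le> n" "n \<le> 1"
    using assms unfolding b coord_def by (auto split: if_splits)
  then consider "n = -1" | "n = 0" | "n = 1" by linarith
  then have "u = v \<and> (b = a \<or> u = 0 \<and> b = across a \<or> u = 1 \<and> b = reflect a)"
    using assms by cases (auto simp: b coord_def across_def reflect_def split: if_splits)
  then show "u = v" "b = a \<or> u = 0 \<and> b = across a \<or> u = 1 \<and> b = reflect a"
    by auto
qed

lemma cell_point_eqD:
  assumes "cell_point r k u v = cell_point r l u' v'" "r > 0"
    "0 \<le> u" "u \<le> 1" "0 \<le> v" "v \<le> 1" "0 \<le> u'" "u' \<le> 1" "0 \<le> v'" "v' \<le> 1"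
  shows "u' = u" "v' = v" "0 < u \<Longrightarrow> u < 1 \<Longrightarrow> 0 < v \<Longrightarrow> v < 1 \<Longrightarrow> l = k"
  using assms coord_eqD[of "fst k" u "fst l" u'] coord_eqD[of "snd k" v "snd l" v']
  by (auto simp: cell_point_def prod_eq_iff)

lemma unit_bounds:
  fixes u v :: real
  assumes "u\<^sup>2 + v\<^sup>2 = 1" "0 \<le> u" "0 \<le> v"
  shows "u \<le> 1" "v \<le> 1" "u < 1 \<longleftrightarrow> 0 < v" "v < 1 \<longleftrightarrow> 0 < u"
proof -
  have *: "x \<le> 1 \<and> (x < 1 \<longleftrightarrow> 0 < y)" if "x\<^sup>2 + y\<^sup>2 = 1" "0 \<le> x" "0 \<le> y" for x y :: real
  proof -
    have "x\<^sup>2 \<le> 1\<^sup>2" using that(1) zero_le_power2[of y] unfolding one_power2 by linarith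
    then have "x \<le> 1" by (rule power2_le_imp_le) simp
    moreover have "x = 1 \<longleftrightarrow> y = 0" using that by (auto simp: power2_eq_1_iff)
    ultimately show ?thesis using that by auto
  qed
  show "u \<le> 1" "v \<le> 1" "u < 1 \<longleftrightarrow> 0 < v" "v < 1 \<longleftrightarrow> 0 < u"
    using *[of u v] *[of v u] assms by (auto simp: add.commute)
qed

text \<open>The values \<open>u\<close>, \<open>v\<close> of a point do not depend on the cell
  chosen for it, so the one equation \<open>u\<^sup>2 + v\<^sup>2 = 1\<close> describes all links of
  the plane at once.\<close>

lemma cell_point_in_arc_iff:
  assumes "r > 0" "0 \<le> u" "u \<le> 1" "0 \<le> v" "v \<le> 1"
  shows "cell_point r k u v \<in> arc_of r l \<Longrightarrow> u\<^sup>2 + v\<^sup>2 = 1"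
    and "0 < u \<Longrightarrow> u < 1 \<Longrightarrow> 0 < v \<Longrightarrow> v < 1 \<Longrightarrow> cell_point r k u v \<in> arc_of r l \<Longrightarrow> l = k"
    and "u\<^sup>2 + v\<^sup>2 = 1 \<Longrightarrow> cell_point r k u v \<in> arc_of r k"
proof -
  assume "cell_point r k u v \<in> arc_of r l"
  then obtain u' v' where "cell_point r k u v = cell_point r l u' v'" "0 \<le> u'" "0 \<le> v'"
    "u'\<^sup>2 + v'\<^sup>2 = 1"
    by (auto simp: arc_of_def)
  note this unit_bounds(1,2)[OF this(4,2,3)]
  then show "u\<^sup>2 + v\<^sup>2 = 1" and "0 < u \<Longrightarrow> u < 1 \<Longrightarrow> 0 < v \<Longrightarrow> v < 1 \<Longrightarrow> l = k"
    using cell_point_eqD[of r k u v l u' v'] assms by auto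
next
  assume "u\<^sup>2 + v\<^sup>2 = 1"
  then show "cell_point r k u v \<in> arc_of r k" using assms by (auto simp: arc_of_def)
qed

lemma cell_point_in_tangle_of:
  assumes "r > 0" "0 < u" "u < 1" "0 < v" "v < 1"
  shows "cell_point r k u v \<in> tangle_of r K \<longleftrightarrow> k \<in> K \<and> u\<^sup>2 + v\<^sup>2 = 1"
  using cell_point_in_arc_iff[of r u v k] assms by (auto simp: tangle_of_def)

lemma center_tile_center_notin_tangle_of:
  assumes "r > 0"
  shows "grid_point r (center k) \<notin> tangle_of r K" "grid_point r (tile_center k) \<notin> tangle_of r K"
  using cell_point_in_arc_iff(1)[OF assms, of 0 0 k] cell_point_in_arc_iff(1)[OF assms, of 1 1 k]
  by (auto simp: tangle_of_def cell_point_ends)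

lemma continuous_on_cell_point [continuous_intros]:
  assumes "continuous_on S f" "continuous_on S g"
  shows "continuous_on S (\<lambda>t. cell_point r k (f t) (g t))"
  unfolding cell_point_def coord_def Complex_eq
    by (cases "even (fst k)"; cases "even (snd k)"; simp;
    intro continuous_intros assms)

section \<open>Sides of a Jordan curve within a cell\<close>

definition jordan :: "complex set \<Rightarrow> bool" where
  "jordan T \<longleftrightarrow> (\<exists>g. simple_path g \<and> pathfinish g = pathstart g \<and> path_image g = T)"

lemma jordanD:
  assumes "jordan T"
  shows "open (inside T)" "open (outside T)" "inside T \<inter> outside T = {}"
    "inside T \<union> outside T = - T" "frontier (inside T) = T" "frontier (outside T) = T"
    "bounded (inside T)" "connected (outside T)" "\<not> bounded (outside T)"
  using assms Jordan_inside_outside unfolding jordan_def by blast+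

lemma jordan_same_side:
  assumes "jordan T" "connected S" "S \<inter> T = {}" "p \<in> S" "q \<in> S"
  shows "p \<in> inside T \<longleftrightarrow> q \<in> inside T"
proof -
  have "inside T \<inter> S = {} \<or> outside T \<inter> S = {}"
    using jordanD[OF assms(1)] assms(2,3) by (intro connectedD) auto
  moreover have "p \<in> inside T \<union> outside T" "q \<in> inside T \<union> outside T"
    using jordanD(4)[OF assms(1)] assms by auto
  ultimately show ?thesis using assms(4,5) jordanD(3)[OF assms(1)] by blast
qed

lemma cell_path_same_side:
  assumes "jordan T" "continuous_on {0..1::real} f" "continuous_on {0..1} g"
    "\<And>t. 0 \<le> t \<Longrightarrow> t \<le> 1 \<Longrightarrow> cell_point r k (f t) (g t) \<notin> T"
  shows "cell_point r k (f 0) (g 0) \<in> inside T \<longleftrightarrow> cell_point r k (f 1) (g 1) \<in> inside T"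
proof (rule jordan_same_side[OF assms(1)])
  show "connected ((\<lambda>t. cell_point r k (f t) (g t)) ` {0..1})"
    by (intro connected_continuous_image continuous_intros assms) auto
qed (use assms in auto)

text \<open>The diagonal of the cell from the center of the link to the tile center meets no link
  but that of the cell.\<close>

lemma tangle_of_free_cell:
  assumes "r > 0" "jordan (tangle_of r K)" "k \<notin> K"
  shows "grid_point r (center k) \<in> inside (tangle_of r K) \<longleftrightarrow>
    grid_point r (tile_center k) \<in> inside (tangle_of r K)"
proof -
  have "cell_point r k t t \<notin> tangle_of r K" if "0 \<le> t" "t \<le> 1" for t
    using that assms cell_point_in_tangle_of[of r t t k K]
      center_tile_center_notin_tangle_of[OF assms(1), of k K]
    by (cases "t = 0"; cases "t = 1") (auto simp: cell_point_ends)
  then show ?thesis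
    using cell_path_same_side[OF assms(2), of "\<lambda>t. t" "\<lambda>t. t" r k] by (simp add: cell_point_ends)
qed

lemma cell_inner_side:
  assumes "r > 0" "jordan (tangle_of r K)" "0 < u" "u < 1" "0 < v" "v < 1" "u\<^sup>2 + v\<^sup>2 < 1"
  shows "cell_point r k u v \<in> inside (tangle_of r K) \<longleftrightarrow>
    grid_point r (center k) \<in> inside (tangle_of r K)"
proof -
  have "cell_point r k (t * u) (t * v) \<notin> tangle_of r K" if t: "0 \<le> t" "t \<le> 1" for t
  proof (cases "t = 0")
    case True
    then show ?thesis using center_tile_center_notin_tangle_of[OF assms(1)] by
      (simp add: cell_point_ends)
  next
    case False
    then have "0 < t * u" "0 < t * v" "t * u < 1" "t * v < 1"
      using t assms by (auto intro: le_less_trans[OF mult_left_le_one_le])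
    moreover have "(t * u)\<^sup>2 + (t * v)\<^sup>2 \<le> u\<^sup>2 + v\<^sup>2"
      using t assms by (intro add_mono power_mono mult_left_le_one_le) auto
    ultimately show ?thesis
      using cell_point_in_tangle_of[OF assms(1)] assms by auto
  qed
  from cell_path_same_side[of "tangle_of r K" "\<lambda>t. t * u"
    "\<lambda>t. t * v", OF assms(2) _ _ this] show ?thesis
    by (simp add: cell_point_ends continuous_intros)
qed

lemma cell_outer_side:
  assumes "r > 0" "jordan (tangle_of r K)" "0 < u" "u < 1" "0 < v" "v < 1" "u\<^sup>2 + v\<^sup>2 > 1"
  shows "cell_point r k u v \<in> inside (tangle_of r K) \<longleftrightarrow>
    grid_point r (tile_center k) \<in> inside (tangle_of r K)"
proof -
  have "cell_point r k (u + t * (1 - u)) (v + t * (1 - v)) \<notin> tangle_of r K" if t: "0 \<le> t" "t \<le> 1"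
    for t
  proof (cases "t = 1")
    case True
    then show ?thesis using center_tile_center_notin_tangle_of[OF assms(1)] by
      (simp add: cell_point_ends)
  next
    case False
    then have "t * (1 - u) < 1 * (1 - u)" "t * (1 - v) < 1 * (1 - v)" "0 \<le> t * (1 - u)"
      "0 \<le> t * (1 - v)"
      using t assms False by (auto intro!: mult_strict_right_mono)
    then have "u + t * (1 - u) < 1" "v + t * (1 - v) < 1" "0 \<le> t * (1 - u)" "0 \<le> t * (1 - v)"
      by auto
    moreover from this have "(u + t * (1 - u))\<^sup>2 + (v + t * (1 - v))\<^sup>2 \<ge> u\<^sup>2 + v\<^sup>2"
      using t assms by (intro add_mono power_mono) auto
    ultimately show ?thesis
      using cell_point_in_tangle_of[OF assms(1), of "u + t * (1 - u)"
        "v + t * (1 - v)" k K] assms by auto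
  qed
  from cell_path_same_side[of "tangle_of r K" "\<lambda>t. u + t * (1 - u)"
    "\<lambda>t. v + t * (1 - v)", OF assms(2) _ _ this]
  show ?thesis
    by (simp add: cell_point_ends continuous_intros)
qed

definition open_cell :: "real \<Rightarrow> cell \<Rightarrow> complex set" where
  "open_cell r k = {cell_point r k u v |u v. 0 < u \<and> u < 1 \<and> 0 < v \<and> v < 1}"

lemma open_open_cell:
  assumes "r > 0"
  shows "open (open_cell r k)"
proof -
  have "open_cell r k = box (grid_point r k) (grid_point r (fst k + 1, snd k + 1))"
  proof (intro equalityI subsetI)
    fix z assume "z \<in> open_cell r k"
    then show "z \<in> box (grid_point r k) (grid_point r (fst k + 1, snd k + 1))"
      using assms by (auto simp: open_cell_def box_def grid_point_def cell_point_def coord_def Basis_complex_def)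
  next
    fix z assume z: "z \<in> box (grid_point r k) (grid_point r (fst k + 1, snd k + 1))"
    define f where "f a x = (if even a then x - of_int a else of_int a + 1 - x)" for a and x :: real
    have "z = cell_point r k (f (fst k) (Re z / r)) (f (snd k) (Im z / r))"
      using assms by (simp add: cell_point_def f_def coord_def complex_eq_iff)
    moreover have "of_int (fst k) < Re z / r" "Re z / r < of_int (fst k) + 1"
       "of_int (snd k) < Im z / r" "Im z / r < of_int (snd k) + 1"
      using z assms by (auto simp: box_def grid_point_def Basis_complex_def field_simps)
    ultimately show "z \<in> open_cell r k"
      unfolding open_cell_def
      by (intro CollectI exI[of _ "f (fst k) (Re z / r)"] exI[of _ "f (snd k) (Im z / r)"])
        (auto simp: f_def)
  qed
  then show ?thesis by (simp add: open_box)
qed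

lemma dist_cell_point_center:
  assumes "r > 0"
  shows "dist (cell_point r k u v) (grid_point r (center k)) = r * sqrt (u\<^sup>2 + v\<^sup>2)"
proof -
  have "(coord a x - coord a 0)\<^sup>2 = x\<^sup>2" for a x by (auto simp: coord_def power2_commute)
  moreover have "dist (cell_point r k u v) (cell_point r k 0 0) =
      sqrt ((r * (coord (fst k) u - coord (fst k) 0))\<^sup>2 + (r * (coord (snd k) v - coord (snd k) 0))\<^sup>2)"
    unfolding cell_point_def dist_norm cmod_def right_diff_distrib by simp
  ultimately have "dist (cell_point r k u v) (cell_point r k 0 0) = sqrt (r\<^sup>2 * (u\<^sup>2 + v\<^sup>2))"
    by (simp add: power_mult_distrib distrib_left)
  then show ?thesis using assms by (simp add: cell_point_ends real_sqrt_mult)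
qed

text \<open>By the Jordan curve theorem every point of the curve is a boundary point of both sides,
  so both sides meet the open cell. The link cuts the cell into only two pieces, one at each of the
  two corners, so these lie on different sides.\<close>

lemma tangle_of_used_cell:
  assumes r: "r > 0" and J: "jordan (tangle_of r K)" and k: "k \<in> K"
  shows "grid_point r (center k) \<in> inside (tangle_of r K) \<longleftrightarrow>
    grid_point r (tile_center k) \<notin> inside (tangle_of r K)"
proof -
  let ?T = "tangle_of r K"
  \<comment> \<open>The Pythagorean triple 3, 4, 5 yields a rational point of the link other than
    its ends.\<close>
  define p where "p = cell_point r k (3/5) (4/5)"
  have "p \<in> ?T"
    using cell_point_in_tangle_of[OF r, of "3/5" "4/5" k K] k by (simp add: p_def power2_eq_square)
  moreover have p: "p \<in> open_cell r k"
    unfolding open_cell_def p_def by (intro CollectI exI[of _ "3/5"] exI[of _ "4/5"]) simp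
  ultimately have "p \<in> closure (inside ?T)" "p \<in> closure (outside ?T)"
    using jordanD(5,6)[OF J] by (auto simp: frontier_def)
  then have "open_cell r k \<inter> inside ?T \<noteq> {}" "open_cell r k \<inter> outside ?T \<noteq> {}"
    using p open_Int_closure_eq_empty[OF open_open_cell[OF r], of k] by blast+
  then obtain z w where z: "z \<in> inside ?T" "z \<in> open_cell r k" and w: "w \<in> outside ?T"
    "w \<in> open_cell r k"
    by blast
  have w': "w \<notin> inside ?T" using w(1) jordanD(3)[OF J] by blast
  have *: "(x \<in> inside ?T \<longleftrightarrow> grid_point r (center k) \<in> inside ?T) \<or> (x \<in> inside ?T \<longleftrightarrow>
    grid_point r (tile_center k) \<in> inside ?T)"
    if x: "x \<in> open_cell r k" "x \<notin> ?T" for x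
  proof -
    obtain u v where uv: "x = cell_point r k u v" "0 < u" "u < 1" "0 < v" "v < 1"
      using x by (auto simp: open_cell_def)
    then have "u\<^sup>2 + v\<^sup>2 \<noteq> 1"
      using x(2) k cell_point_in_tangle_of[OF r uv(2-5), of k K] by auto
    then show ?thesis
      using cell_inner_side[OF r J uv(2-5)] cell_outer_side[OF r J uv(2-5)] uv(1)
      by (metis linorder_neqE_linordered_idom)
  qed
  have nT: "z \<notin> ?T" "w \<notin> ?T" using z(1) w(1) jordanD(4)[OF J] by blast+
  show ?thesis using *[OF z(2) nT(1)] *[OF w(2) nT(2)] z(1) w' by blast
qed

lemma tangle_of_sides:
  assumes "r > 0" "jordan (tangle_of r K)"
  shows "sides K (\<lambda>v. grid_point r v \<in> inside (tangle_of r K))"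
  unfolding sides_def using tangle_of_free_cell[OF assms] tangle_of_used_cell[OF assms] by blast

text \<open>Before it reaches \<open>p\<close>, the radius to \<open>p\<close> has
  \<open>u\<^sup>2 + v\<^sup>2 < 1\<close> and so avoids every link. This includes the ends of the
  link, where the radius runs along the border of the cell.\<close>

lemma arc_point_side:
  assumes "r > 0" "jordan (tangle_of r K)" "p \<in> arc_of r k" "p \<notin> tangle_of r K"
  shows "p \<in> inside (tangle_of r K) \<longleftrightarrow> grid_point r (center k) \<in> inside (tangle_of r K)"
proof -
  obtain u v where p: "p = cell_point r k u v" "0 \<le> u" "0 \<le> v" "u\<^sup>2 + v\<^sup>2 = 1"
    using assms(3) by (auto simp: arc_of_def)
  note uv = unit_bounds(1,2)[OF p(4,2,3)]
  have "cell_point r k (t * u) (t * v) \<notin> tangle_of r K" if t: "0 \<le> t" "t \<le> 1" for t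
  proof (cases "t = 1")
    case False
    have "(t * u)\<^sup>2 + (t * v)\<^sup>2 = t\<^sup>2" using p(4) by
      (simp add: power_mult_distrib flip: distrib_left)
    then have "(t * u)\<^sup>2 + (t * v)\<^sup>2 \<noteq> 1" using t False by (auto simp: power2_eq_1_iff)
    moreover have "0 \<le> t * u" "t * u \<le> 1" "0 \<le> t * v" "t * v \<le> 1"
      using t p uv by (auto intro: mult_le_one)
    ultimately show ?thesis
      using cell_point_in_arc_iff(1)[OF assms(1), of "t * u"
        "t * v" k] unfolding tangle_of_def by blast
  qed (use assms(4) p in auto)
  from cell_path_same_side[of "tangle_of r K" "\<lambda>t. t * u"
    "\<lambda>t. t * v", OF assms(2) _ _ this] show ?thesis
    by (simp add: cell_point_ends continuous_intros p(1))
qed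

lemma arc_interior_local:
  assumes r: "r > 0" and J: "jordan (tangle_of r K)" and k: "k \<in> K" and p: "p \<in> open_cell r k"
    and c: "grid_point r (center k) \<in> inside (tangle_of r K)"
  shows "\<exists>e>0. inside (tangle_of r K) \<inter> ball p e = ball (grid_point r (center k)) r \<inter> ball p e"
proof -
  obtain e where e: "e > 0" "ball p e \<subseteq> open_cell r k"
    using open_open_cell[OF r] p by (meson open_contains_ball)
  have "q \<in> inside (tangle_of r K) \<longleftrightarrow> q \<in> ball (grid_point r (center k)) r" if q': "q \<in> ball p e"
    for q
  proof -
    obtain u v where q: "q = cell_point r k u v" and uv: "0 < u" "u < 1" "0 < v" "v < 1"
      using e(2) q' unfolding open_cell_def by blast
    have ball: "q \<in> ball (grid_point r (center k)) r \<longleftrightarrow> u\<^sup>2 + v\<^sup>2 < 1"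
      using r by (simp add: q dist_cell_point_center dist_commute[of "grid_point r (center k)"])
    consider "u\<^sup>2 + v\<^sup>2 < 1" | "u\<^sup>2 + v\<^sup>2 = 1" | "u\<^sup>2 + v\<^sup>2 > 1" by linarith
    then show ?thesis
    proof cases
      case 1
      then show ?thesis using cell_inner_side[OF r J uv, of k] ball c q by simp
    next
      case 2
      then have "q \<in> tangle_of r K" using cell_point_in_tangle_of[OF r uv] k q by simp
      then have "q \<notin> inside (tangle_of r K)" using jordanD(4)[OF J] by blast
      then show ?thesis using 2 ball by simp
    next
      case 3
      then show ?thesis
        using cell_outer_side[OF r J uv, of k] tangle_of_used_cell[OF r J k] ball c q by simp
    qed
  qed
  then show ?thesis using e(1) by blast
qed

lemma arc_interior_outside:
  assumes r: "r > 0" and J: "jordan (tangle_of r K)" and p: "p \<in> open_cell r k" "p \<in> arc_of r k"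
    and c: "grid_point r (center k) \<notin> inside (tangle_of r K)" and e: "e > 0"
  shows "inside (tangle_of r K) \<inter> ball p e \<noteq> ball (grid_point r (center k)) r \<inter> ball p e"
proof -
  obtain u v where q: "p = cell_point r k u v" and uv: "0 < u" "u < 1" "0 < v" "v < 1"
    using p by (auto simp: open_cell_def)
  have "u\<^sup>2 + v\<^sup>2 = 1"
    using cell_point_in_arc_iff(1)[OF r] uv p q by (metis less_imp_le)
  then have "dist p (grid_point r (center k)) = r" using r by (simp add: q dist_cell_point_center)
  then have "p \<in> closure (ball (grid_point r (center k)) r)" using r by (simp add: dist_commute)
  moreover have "open (ball p e \<inter> open_cell r k)" "p \<in> ball p e \<inter> open_cell r k"
    using open_Int[OF open_ball open_open_cell[OF r]] p e by auto
  ultimately have "ball p e \<inter> open_cell r k \<inter> ball (grid_point r (center k)) r \<noteq> {}"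
    using open_Int_closure_eq_empty by blast
  then obtain z where z: "z \<in> ball (grid_point r (center k)) r" "z \<in> ball p e" "z \<in> open_cell r k"
    by blast
  then obtain u' v' where z': "z = cell_point r k u' v'" "0 < u'" "u' < 1" "0 < v'" "v' < 1"
    by (auto simp: open_cell_def)
  then have "u'\<^sup>2 + v'\<^sup>2 < 1"
    using z(1) r by (simp add: dist_cell_point_center dist_commute[of "grid_point r (center k)"])
  then have "z \<notin> inside (tangle_of r K)"
    using cell_inner_side[OF r J z'(2-5)] c z'(1) by simp
  then show ?thesis using z by blast
qed

section \<open>Links meet only at tangency points\<close>

lemma grid_point_inj: "r > 0 \<Longrightarrow> grid_point r x = grid_point r y \<longleftrightarrow> x = y"
  by (auto simp: grid_point_def prod_eq_iff)

lemma arcs_meet: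
  assumes r: "r > 0" and p: "p \<in> arc_of r k"
  obtains "p \<in> open_cell r k" | "p = grid_point r (src k)" | "p = grid_point r (tgt k)"
proof -
  obtain u v where u: "p = cell_point r k u v" "0 \<le> u" "0 \<le> v" "u\<^sup>2 + v\<^sup>2 = 1"
    using p by (auto simp: arc_of_def)
  note uv = unit_bounds[OF u(4,2,3)]
  consider "0 < u" "0 < v" | "u = 0" "v = 1" | "v = 0" "u = 1"
    using uv u by (auto simp: power2_eq_1_iff) 
  then show thesis
  proof cases
    case 1
    then show ?thesis using that(1) uv u by (auto simp: open_cell_def)
  next
    case 2
    then show ?thesis using that u(1) cell_point_ends(4,5)[of k r] by (cases "even_tile k") auto
  next
    case 3
    then show ?thesis using that u(1) cell_point_ends(3,6)[of k r] by (cases "even_tile k") auto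
  qed
qed

lemma ends_in_arc:
  assumes "r > 0"
  shows "grid_point r (src k) \<in> arc_of r k" "grid_point r (tgt k) \<in> arc_of r k"
  using cell_point_in_arc_iff(3)[OF assms, of 1 0 k] cell_point_in_arc_iff(3)[OF assms, of 0 1 k]
  by (cases "even_tile k"; simp add: cell_point_ends)+

lemma open_cell_arc:
  assumes "r > 0" "p \<in> open_cell r k" "p \<in> arc_of r l"
  shows "l = k"
proof -
  obtain u v where "p = cell_point r k u v" "0 < u" "u < 1" "0 < v" "v < 1"
    using assms(2) unfolding open_cell_def by blast
  then show ?thesis using cell_point_in_arc_iff(2)[OF assms(1), of u v k l] assms(3) by simp
qed

lemma node_notin_open_cell:
  assumes "r > 0"
  shows "grid_point r (src l) \<notin> open_cell r k" "grid_point r (tgt l) \<notin> open_cell r k"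
proof -
  have *: "cell_point r l (of_bool b) (of_bool (\<not> b)) \<notin> open_cell r k" for b
    using cell_point_eqD(1)[OF _ assms, of l "of_bool b" "of_bool (\<not> b)" k]
      by (fastforce simp: open_cell_def)
  show "grid_point r (src l) \<notin> open_cell r k" "grid_point r (tgt l) \<notin> open_cell r k"
    using *[of True] *[of False] by (cases "even_tile l"; simp add: cell_point_ends)+
qed

lemma arc_disjoint:
  assumes r: "r > 0" and p: "p \<in> arc_of r k" "p \<in> arc_of r l" and "k \<noteq> l"
  obtains x where "p = grid_point r x" "x \<in> {src k, tgt k}" "x \<in> {src l, tgt l}"
proof -
  have "p \<notin> open_cell r k" "p \<notin> open_cell r l"
    using open_cell_arc[OF r] p assms(4) by blast+
  then have "p = grid_point r (src k) \<or> p = grid_point r (tgt k)"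
    "p = grid_point r (src l) \<or> p = grid_point r (tgt l)"
    using arcs_meet[OF r p(1)] arcs_meet[OF r p(2)] by blast+
  then show ?thesis using that grid_point_inj[OF r] by (metis insertCI)
qed

lemma arc_subset_tangle_of:
  assumes "r > 0" "arc_of r k \<subseteq> tangle_of r K"
  shows "k \<in> K"
proof -
  have "cell_point r k (3/5) (4/5) \<in> arc_of r k"
    using cell_point_in_arc_iff(3)[OF assms(1), of "3/5" "4/5" k] by (simp add: power2_eq_square)
  then show ?thesis
    using assms cell_point_in_tangle_of[OF assms(1), of "3/5" "4/5" k K] by auto
qed

section \<open>Cells and links\<close>

text \<open>The position of the cell as seen from the center of its link, counted counterclockwise
  from the upper right.\<close>

definition quadrant :: "cell \<Rightarrow> nat" where
  "quadrant k = (if even (snd k) then (if even (fst k) then 0 else 1) else (if even (fst k) then 3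
    else 2))"

definition link_of :: "real \<Rightarrow> cell \<Rightarrow> link" where
  "link_of r k = (grid_point r (center k), quadrant k)"

text \<open>While \<open>link_path\<close> always runs counterclockwise, this one runs from
  \<open>src k\<close> to \<open>tgt k\<close>, so that the links of a cycle fit together.\<close>

definition cell_path :: "real \<Rightarrow> cell \<Rightarrow> real \<Rightarrow> complex" where
  "cell_path r k t = (if even_tile k then cell_point r k (cos (t * pi / 2)) (sin (t * pi / 2))
     else cell_point r k (sin (t * pi / 2)) (cos (t * pi / 2)))"

text \<open>Counterclockwise means from the horizontal to the vertical axis in even quadrants and
  the other way in odd ones.\<close>

lemma link_path_link_of:
  "link_path r (link_of r k) t = (if even (quadrant k) then
    cell_point r k (cos (t * pi / 2)) (sin (t * pi / 2))
     else cell_point r k (sin (t * pi / 2)) (cos (t * pi / 2)))"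
proof -
  define q where "q = quadrant k"
  have "linepath (real q * pi / 2) ((real q + 1) * pi / 2) t = t * pi / 2 + real q * (pi / 2)"
    by (simp add: linepath_def field_simps)
  then have "link_path r (link_of r k) t = grid_point r (center k) + r * cis (t * pi / 2 + real q * (pi / 2))"
    by (simp add: link_path_def link_of_def part_circlepath_def cis_conv_exp q_def)
  also have "\<dots> = grid_point r (center k) + r * cis (t * pi / 2) * cis (pi / 2) ^ q"
    unfolding Complex.DeMoivre by (simp add: mult.assoc flip: cis_mult)
  also have "\<dots> = grid_point r (center k) + r * cis (t * pi / 2) * \<i> ^ q" by simp
  finally have 1: "link_path r (link_of r k) t = cell_point r k 0 0 + r * cis (t * pi / 2) * \<i> ^ q"
    by (simp add: cell_point_ends)
  show ?thesis
    unfolding 1 unfolding q_def quadrant_def cell_point_def coord_def complex_eq_iff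
    by (auto simp: power2_eq_square power3_eq_cube algebra_simps)
qed

lemma range_link_of:
  assumes "r > 0"
  shows "range (link_of r) = links r"
proof (intro equalityI subsetI)
  fix l assume "l \<in> range (link_of r)"
  then obtain a b where "l = link_of r (a, b)" by auto
  then have "l = (Complex (2 * r * of_int (ceil_half a)) (2 * r * of_int (ceil_half b)), quadrant (a, b))"
    by (simp add: link_of_def grid_point_def center.simps)
  moreover have "quadrant (a, b) < 4" by (simp add: quadrant_def)
  ultimately show "l \<in> links r"
    by (auto simp: links_def tiling_vertices_def)
next
  fix l assume "l \<in> links r"
  then obtain i j q where l: "l = (Complex (2 * r * of_int i) (2 * r * of_int j), q)" and q: "q < 4"
    by (auto simp: links_def tiling_vertices_def)
  have ceil_half: "ceil_half (2 * m) = m" "ceil_half (2 * m - 1) = m" for m by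
    (auto simp: ceil_half_def)
  have "q = 0 \<or> q = 1 \<or> q = 2 \<or> q = 3" using q by auto
  then have "\<exists>a b. l = link_of r (a, b)"
  proof (elim disjE)
    assume "q = 0" then show ?thesis
      by (intro exI[of _ "2 * i"] exI[of _ "2 * j"])
        (simp add: l link_of_def grid_point_def center.simps ceil_half quadrant_def)
  next
    assume "q = 1" then show ?thesis
      by (intro exI[of _ "2 * i - 1"] exI[of _ "2 * j"])
        (simp add: l link_of_def grid_point_def center.simps ceil_half quadrant_def)
  next
    assume "q = 2" then show ?thesis
      by (intro exI[of _ "2 * i - 1"] exI[of _ "2 * j - 1"])
        (simp add: l link_of_def grid_point_def center.simps ceil_half quadrant_def)
  next
    assume "q = 3" then show ?thesis
      by (intro exI[of _ "2 * i"] exI[of _ "2 * j - 1"])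
        (simp add: l link_of_def grid_point_def center.simps ceil_half quadrant_def)
  qed
  then show "l \<in> range (link_of r)" by auto
qed

lemma quarter_param:
  assumes "0 \<le> u" "0 \<le> v" "u\<^sup>2 + v\<^sup>2 = 1"
  obtains t where "0 \<le> t" "t \<le> 1" "u = cos (t * pi / 2)" "v = sin (t * pi / 2)"
proof -
  obtain x where x: "0 \<le> x" "x \<le> pi / 2" "u = cos x" "v = sin x"
    using sincos_total_pi_half[OF assms] by auto
  show ?thesis
    by (rule that[of "x * 2 / pi"]) (use x in \<open>auto simp: field_simps\<close>)
qed

lemma quarter_bounds:
  assumes "0 \<le> t" "t \<le> 1"
  shows "0 \<le> cos (t * pi / 2)" "0 \<le> sin (t * pi / 2)"
proof -
  have "t * pi \<le> 1 * pi" using assms by (intro mult_right_mono) auto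
  moreover have "0 \<le> t * pi" using assms by simp
  ultimately show "0 \<le> cos (t * pi / 2)" "0 \<le> sin (t * pi / 2)"
    using pi_gt_zero by (intro cos_ge_zero sin_ge_zero; linarith)+
qed

lemma image_cos_sin:
  "(\<lambda>t. cell_point r k (cos (t * pi / 2)) (sin (t * pi / 2))) ` {0..1} = arc_of r k" (is "?A = _")
  "(\<lambda>t. cell_point r k (sin (t * pi / 2)) (cos (t * pi / 2))) ` {0..1} = arc_of r k" (is "?B = _")
proof -
  have "?A \<subseteq> arc_of r k" "?B \<subseteq> arc_of r k"
    using quarter_bounds by (fastforce simp: arc_of_def)+
  moreover have "p \<in> ?A \<and> p \<in> ?B" if "p \<in> arc_of r k" for p
  proof -
    obtain u v where p: "p = cell_point r k u v" "0 \<le> u" "0 \<le> v" "u\<^sup>2 + v\<^sup>2 = 1"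
      using \<open>p \<in> arc_of r k\<close> by (auto simp: arc_of_def)
    obtain t where "0 \<le> t" "t \<le> 1" "u = cos (t * pi / 2)" "v = sin (t * pi / 2)"
      using quarter_param[OF p(2-4)] .
    moreover obtain t' where "0 \<le> t'" "t' \<le> 1" "v = cos (t' * pi / 2)" "u = sin (t' * pi / 2)"
      using quarter_param[OF p(3,2)] p(4) by (metis add.commute)
    ultimately show ?thesis using p(1) by force
  qed
  ultimately show "?A = arc_of r k" "?B = arc_of r k" by blast+
qed

lemma cell_path_image: "cell_path r k ` {0..1} = arc_of r k"
  using image_cos_sin[of r k] by (cases "even_tile k") (simp_all add: cell_path_def[abs_def])

lemma link_arc_link_of: "link_arc r (link_of r k) = arc_of r k"
  using image_cos_sin[of r k] by (cases "even (quadrant k)")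
    (simp_all add: link_arc_def path_image_def link_path_link_of[abs_def])

lemma link_ends_link_of: "link_ends r (link_of r k) = {grid_point r (src k), grid_point r (tgt k)}"
  by (cases "even (quadrant k)"; cases "even_tile k")
    (auto simp: link_ends_def pathstart_def pathfinish_def link_path_link_of cell_point_ends)

lemma inj_link_of:
  assumes "r > 0"
  shows "inj (link_of r)"
proof (rule injI)
  fix k l assume "link_of r k = link_of r l"
  then have "arc_of r k = arc_of r l" by (metis link_arc_link_of)
  then have "arc_of r k \<subseteq> tangle_of r {l}" by (simp add: tangle_of_def)
  then show "k = l" using arc_subset_tangle_of[OF assms] by blast
qed

lemma tangle_links_tangle_of:
  assumes "r > 0"
  shows "tangle_links r (tangle_of r K) = link_of r ` K"
proof -
  have "link_of r k \<in> tangle_links r (tangle_of r K) \<longleftrightarrow> k \<in> K" for k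
    using arc_subset_tangle_of[OF assms, of k K] range_link_of[OF assms]
    by (auto simp: tangle_links_def link_arc_link_of tangle_of_def)
  moreover have "tangle_links r (tangle_of r K) \<subseteq> range (link_of r)"
    using range_link_of[OF assms] by (auto simp: tangle_links_def)
  ultimately show ?thesis by blast
qed

lemma square_tangle_tangle_of_iff:
  assumes "r > 0"
  shows "square_tangle r T \<longleftrightarrow> smooth_simple_closed_curve T \<and> (\<exists>K. finite K \<and> T = tangle_of r K)"
proof -
  have "(\<exists>L. finite L \<and> L \<subseteq> links r \<and> T = (\<Union>l\<in>L. link_arc r l)) \<longleftrightarrow> (\<exists>K. finite K \<and>
    T = tangle_of r K)"
  proof
    assume "\<exists>L. finite L \<and> L \<subseteq> links r \<and> T = (\<Union>l\<in>L. link_arc r l)"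
    then obtain L where L: "finite L" "L \<subseteq> range (link_of r)" "T = (\<Union>l\<in>L. link_arc r l)"
      using range_link_of[OF assms] by auto
    then obtain K where "finite K" "L = link_of r ` K" by (meson finite_subset_image)
    with L(3) show "\<exists>K. finite K \<and> T = tangle_of r K" by (auto simp: tangle_of_def link_arc_link_of)
  next
    assume "\<exists>K. finite K \<and> T = tangle_of r K"
    then obtain K where "finite K" "T = tangle_of r K" by blast
    then show "\<exists>L. finite L \<and> L \<subseteq> links r \<and> T = (\<Union>l\<in>L. link_arc r l)"
      using range_link_of[OF assms] by (intro exI[of _ "link_of r ` K"])
        (auto simp: tangle_of_def link_arc_link_of)
  qed
  then show ?thesis by (simp add: square_tangle_def)
qed

lemma smooth_jordan: "smooth_simple_closed_curve T \<Longrightarrow> jordan T"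
  by (auto simp: smooth_simple_closed_curve_def jordan_def)

lemma convex_link_iff:
  assumes "r > 0" "jordan (tangle_of r K)"
  shows "convex_link r (tangle_of r K) (link_of r k) \<longleftrightarrow> k \<in> K \<and>
    grid_point r (center k) \<in> inside (tangle_of r K)"
proof -
  have center: "fst (link_of r k) = grid_point r (center k)" by (simp add: link_of_def)
  have mem: "link_of r k \<in> tangle_links r (tangle_of r K) \<longleftrightarrow> k \<in> K"
    using inj_link_of[OF assms(1)] by (auto simp: tangle_links_tangle_of[OF assms(1)] inj_image_mem_iff)
  have interior: "link_arc r (link_of r k) - link_ends r (link_of r k) = arc_of r k \<inter> open_cell r k"
    using arcs_meet[OF assms(1), of _ k] node_notin_open_cell[OF assms(1)]
    unfolding link_arc_link_of link_ends_link_of by blast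
  \<comment> \<open>Convexity quantifies over the non-endpoints of the link; refuting it when the
    center is not enclosed takes one such point.\<close>
  define p where "p = cell_point r k (3/5) (4/5)"
  have p: "p \<in> arc_of r k \<inter> open_cell r k"
    using cell_point_in_arc_iff(3)[OF assms(1), of "3/5" "4/5" k]
    unfolding open_cell_def p_def
    by (intro IntI CollectI exI[of _ "3/5"] exI[of _ "4/5"]) (auto simp: power2_eq_square)
  show ?thesis
    unfolding convex_link_def mem center interior
    using arc_interior_local[OF assms] arc_interior_outside[OF assms] p by blast
qed

section \<open>Directed cycles are smooth curves\<close>

text \<open>The slope of \<open>coord a\<close>.\<close>

definition cell_sign :: "int \<Rightarrow> real" where "cell_sign a = (if even a then 1 else -1)"

definition cell_path' :: "real \<Rightarrow> cell \<Rightarrow> real \<Rightarrow> complex" where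
  "cell_path' r k t = r * pi / 2 * (if even_tile k
     then Complex (- cell_sign (fst k) * sin (t * pi / 2)) (cell_sign (snd k) * cos (t * pi / 2))
     else Complex (cell_sign (fst k) * cos (t * pi / 2)) (- cell_sign (snd k) * sin (t * pi / 2)))"

lemma cell_path_has_derivative: "(cell_path r k has_vector_derivative cell_path' r k t) (at t within S)"
  unfolding cell_path_def cell_path'_def cell_point_def coord_def cell_sign_def
  by (cases "even_tile k"; cases "even (fst k)"; cases "even (snd k)")
    (auto intro!: derivative_eq_intros simp: has_vector_derivative_complex_iff)

lemma continuous_cell_path': "continuous_on S (cell_path' r k)"
  unfolding cell_path'_def Complex_eq by (cases "even_tile k") (auto intro!: continuous_intros)

lemma cell_path'_nonzero: "r > 0 \<Longrightarrow> cell_path' r k t \<noteq> 0"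
  by (auto simp: cell_path'_def cell_sign_def complex_eq_iff split: if_splits dest: sin_zero_norm_cos_one)

lemma cell_path_ends: "cell_path r k 0 = grid_point r (src k)"
  "cell_path r k 1 = grid_point r (tgt k)"
  by (simp_all add: cell_path_def cell_point_ends)

lemma cell_sign_flip [simp]: "cell_sign (reflect a) = - cell_sign a"
  "cell_sign (across a) = - cell_sign a"
  by (auto simp: cell_sign_def reflect_def across_def)

text \<open>Links leave a tile horizontally if \<open>even_tile\<close>, and vertically otherwise.
  Either way of continuing mirrors the cell in that direction, which reverses
  \<open>cell_sign\<close> there.\<close>

lemma cell_path'_chain:
  assumes "tgt k = src l"
  shows "cell_path' r k 1 = cell_path' r l 0"
proof -
  have "if even_tile k then \<not> even_tile l \<and> cell_sign (fst l) = - cell_sign (fst k)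
    else even_tile l \<and> cell_sign (snd l) = - cell_sign (snd k)"
    using assms unfolding tgt_src_iff
    by (cases k) (auto simp: turn.simps tgt_flip.simps even_tile.simps)
  then show ?thesis by (cases "even_tile k") (auto simp: cell_path'_def)
qed

lemma cell_path_inj:
  assumes "r > 0" "0 \<le> s" "s \<le> 1" "0 \<le> t" "t \<le> 1" "cell_path r k s = cell_path r k t"
  shows "s = t"
proof -
  have "cos (s * pi / 2) = cos (t * pi / 2)"
    using assms by (cases "even_tile k") (auto simp: cell_path_def cell_point_def coord_def split: if_splits)
  moreover have "0 \<le> x * pi / 2 \<and> x * pi / 2 \<le> pi" if "0 \<le> x" "x \<le> 1" for x
    using that mult_right_mono[of x 1 pi] mult_nonneg_nonneg[of x pi] pi_gt_zero by linarith
  ultimately have "s * pi / 2 = t * pi / 2"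
    using assms(2-5) cos_inj_pi[of "s * pi / 2" "t * pi / 2"] by metis
  then show ?thesis by simp
qed

lemma has_vector_derivative_glue:
  assumes "(f has_vector_derivative D) (at t within {..t})"
    "(f has_vector_derivative D) (at t within {t..})"
  shows "(f has_vector_derivative D) (at (t::real))"
proof -
  have "(f has_vector_derivative D) (at t within ({..t} \<union> {t..}))"
    using assms unfolding has_vector_derivative_def has_derivative_within
    by (auto simp: Lim_within_Un)
  moreover have "{..t} \<union> {t..} = UNIV" by auto
  ultimately show ?thesis by simp
qed

text \<open>The cycle is unrolled to a sequence over all integers. The curve then lives on the whole
  real line, and the point where it closes up is a junction like any other, with two-sided
  derivatives.\<close>

locale cell_chain =
  fixes r :: real and K :: "int \<Rightarrow> cell"
  assumes r: "r > 0" and chain: "\<And>i. tgt (K i) = src (K (i + 1))"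
begin

definition curve :: "real \<Rightarrow> complex" where "curve t = cell_path r (K \<lfloor>t\<rfloor>) (t - of_int \<lfloor>t\<rfloor>)"
definition curve' :: "real \<Rightarrow> complex" where "curve' t = cell_path' r (K \<lfloor>t\<rfloor>) (t - of_int \<lfloor>t\<rfloor>)"

text \<open>The gain is the right end of the interval: there \<open>curve\<close> and
  \<open>curve'\<close> are defined by the next link, and the two descriptions agree because
  position and velocity match.\<close>

lemma curve_eq:
  assumes "of_int i \<le> t" "t \<le> of_int i + 1"
  shows "curve t = cell_path r (K i) (t - of_int i)" "curve' t = cell_path' r (K i) (t - of_int i)"
proof -
  have "\<lfloor>t\<rfloor> = i \<or> t = of_int (i + 1)" using assms by linarith
  then show "curve t = cell_path r (K i) (t - of_int i)"
    "curve' t = cell_path' r (K i) (t - of_int i)"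
    using chain[of i] cell_path'_chain[OF chain[of i]] by
      (auto simp: curve_def curve'_def cell_path_ends)
qed

lemma cell_path_shift: "((\<lambda>t. cell_path r k (t - c)) has_vector_derivative cell_path' r k (t - c)) (at t within S)"
proof -
  have "((\<lambda>t. t - c) has_vector_derivative 1) (at t within S)"
    by (auto intro!: derivative_eq_intros)
  from vector_diff_chain_within[OF this cell_path_has_derivative] show ?thesis by (simp add: o_def)
qed

lemma curve_derivative: "(curve has_vector_derivative curve' t) (at t)"
proof (rule has_vector_derivative_glue)
  \<comment> \<open>For an integer \<open>t\<close> this is the link that ends at \<open>t\<close>,
    whereas the floor used below gives the one that begins there.\<close>
  define i where "i = \<lceil>t\<rceil> - 1"
  have i: "of_int i < t" "t \<le> of_int i + 1" unfolding i_def by linarith+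
  show "(curve has_vector_derivative curve' t) (at t within {..t})"
    unfolding curve_eq(2)[OF less_imp_le[OF i(1)] i(2)]
    by (rule has_vector_derivative_transform_within[OF cell_path_shift[of "K i"
      "of_int i" t "{..t}"], of "t - of_int i"])
      (use i in \<open>auto simp: dist_real_def curve_eq(1)[of i]\<close>)
next
  define i where "i = \<lfloor>t\<rfloor>"
  have i: "of_int i \<le> t" "t < of_int i + 1" unfolding i_def by linarith+
  show "(curve has_vector_derivative curve' t) (at t within {t..})"
    unfolding curve_eq(2)[OF i(1) less_imp_le[OF i(2)]]
    by (rule has_vector_derivative_transform_within[OF cell_path_shift[of "K i"
      "of_int i" t "{t..}"], of "of_int i + 1 - t"])
      (use i in \<open>auto simp: dist_real_def curve_eq(1)[of i]\<close>)
qed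

lemma curve'_continuous: "continuous_on UNIV curve'"
proof -
  have cont: "continuous_on {of_int i..of_int i + 1} curve'" for i
  proof -
    have "continuous_on {of_int i..of_int i + 1} (\<lambda>t. cell_path' r (K i) (t - of_int i))"
      by (rule continuous_on_compose2[OF continuous_cell_path'[of UNIV]])
        (auto intro!: continuous_intros)
    then show ?thesis by (subst continuous_on_cong[OF refl curve_eq(2)[of i]]) auto
  qed
  have "continuous (at t) curve'" for t
  proof -
    define i where "i = \<lceil>t\<rceil> - 1"
    have i: "of_int i < t" "t \<le> of_int i + 1" unfolding i_def by linarith+
    have "continuous_on ({of_int i..of_int i + 1} \<union> {of_int (i + 1)..of_int (i + 1) + 1}) curve'"
      by (intro continuous_on_closed_Un cont) auto
    also have "{of_int i..of_int i + 1} \<union> {of_int (i + 1)..of_int (i + 1) + 1} = {of_int i..of_int i + 2::real}"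
      by auto
    finally show ?thesis
      using i by (intro continuous_on_interior[of "{of_int i..of_int i + 2}"])
        (auto simp: interior_atLeastAtMost_real)
  qed
  then show ?thesis by (simp add: continuous_on_eq_continuous_at)
qed

lemma curve'_nonzero: "curve' t \<noteq> 0"
  unfolding curve'_def by (rule cell_path'_nonzero[OF r])

end

lemma cell_cycle_smooth:
  assumes r: "r > 0" and cyc: "cell_cycle ks"
  shows "smooth_simple_closed_curve (tangle_of r (set ks))"
proof -
  define n where "n = length ks"
  have n: "n > 0" using cyc by (auto simp: n_def cell_cycle_def)
  define K where "K i = ks ! nat (i mod int n)" for i
  have K_in: "K i \<in> set ks" for i
    using n unfolding K_def n_def by (intro nth_mem) (simp add: nat_less_iff)
  have chain: "tgt (K i) = src (K (i + 1))" for i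
  proof -
    define j where "j = nat (i mod int n)"
    have j: "j < n" "int j = i mod int n" using n by (auto simp: j_def nat_less_iff)
    have eq: "(i + 1) mod int n = (int j + 1) mod int n" by (simp add: j(2) mod_add_left_eq)
    show ?thesis
    proof (cases "Suc j = n")
      case True
      then have "(i + 1) mod int n = 0" unfolding eq by
        (auto simp: add.commute simp flip: of_nat_Suc)
      then show ?thesis
        using cyc True unfolding K_def j_def[symmetric]
        by (auto simp: cell_cycle_def last_conv_nth hd_conv_nth n_def dest: sym)
    next
      case False
      then have "(i + 1) mod int n = int (Suc j)" unfolding eq using j(1) by auto
      then show ?thesis
        using cyc False j(1) unfolding K_def j_def[symmetric]
        by (auto simp: cell_cycle_def successively_conv_nth n_def simp del: of_nat_Suc)
    qed
  qed
  interpret cell_chain r K by unfold_locales (use r chain in auto)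
  have inj: "s = t" if st: "curve s = curve t" "0 \<le> s" "s < real n" "0 \<le> t" "t < real n" for s t
  proof -
    define i j where "i = \<lfloor>s\<rfloor>" and "j = \<lfloor>t\<rfloor>"
    have ij: "0 \<le> i" "i < n" "0 \<le> j" "j < n" "of_int i \<le> s" "s < of_int i + 1" "of_int j \<le> t"
      "t < of_int j + 1"
      using st by (auto simp: i_def j_def floor_less_iff)
    have eq: "cell_path r (K i) (s - of_int i) = cell_path r (K j) (t - of_int j)"
      using st(1) by (simp add: curve_def i_def j_def)
    have src: "src (K i) = src (K j) \<Longrightarrow> i = j"
      using cyc ij nth_eq_iff_index_eq[of "map src ks" "nat i" "nat j"]
      by (simp add: cell_cycle_def K_def n_def nat_less_iff)
    have "K i = K j"
    proof (rule ccontr)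
      assume ne: "K i \<noteq> K j"
      have "cell_path r (K i) (s - of_int i) \<in> arc_of r (K i)"
        "cell_path r (K j) (t - of_int j) \<in> arc_of r (K j)"
        using ij unfolding cell_path_image[symmetric] by auto
      then obtain x where x: "cell_path r (K i) (s - of_int i) = grid_point r x"
        "x \<in> {src (K i), tgt (K i)}" "x \<in> {src (K j), tgt (K j)}"
        using arc_disjoint[OF r _ _ ne] eq by metis
      \<comment> \<open>The parameters lie in half-open intervals, so a common node is the source of
        both links, and sources are distinct along the cycle.\<close>
      have "x \<noteq> tgt (K i)" "x \<noteq> tgt (K j)"
        using cell_path_inj[OF r, of "s - of_int i" 1 "K i"]
          cell_path_inj[OF r, of "t - of_int j" 1 "K j"] x(1) eq ij
        by (auto simp: cell_path_ends)
      then show False using x(2,3) src ne by auto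
    qed
    then have "i = j" using src by simp
    then show ?thesis using cell_path_inj[OF r _ _ _ _ eq[unfolded \<open>K i = K j\<close>]] ij by simp
  qed
  define g where "g t = curve (real n * t)" for t
  have ends: "curve (real n) = curve 0" "curve' (real n) = curve' 0"
    by (simp_all add: curve_def curve'_def K_def)
  have g': "(g has_vector_derivative (real n * curve' (real n * t))) (at t)" for t
  proof -
    have "((\<lambda>t. real n * t) has_vector_derivative real n) (at t)"
      by (auto intro!: derivative_eq_intros)
    from vector_diff_chain_at[OF this curve_derivative] show ?thesis
      by (simp add: o_def scaleR_conv_of_real g_def[abs_def])
  qed
  have "continuous_on S g" for S
    using g' by (meson continuous_at_imp_continuous_on has_vector_derivative_continuous)
  then have "path g" by (simp add: path_def)
  moreover have "loop_free g"
    unfolding loop_free_def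
  proof (intro ballI impI)
    fix s t :: real assume st: "s \<in> {0..1}" "t \<in> {0..1}" "g s = g t"
    have "s = t" if "s < 1" "t < 1"
      using inj[of "real n * s" "real n * t"] st that n by (auto simp: g_def)
    moreover have "s = 0" if "t = 1" "s < 1"
      using inj[of "real n * s" 0] st that n ends by (auto simp: g_def)
    moreover have "t = 0" if "s = 1" "t < 1"
      using inj[of 0 "real n * t"] st that n ends by (auto simp: g_def)
    ultimately show "s = t \<or> s = 0 \<and> t = 1 \<or> s = 1 \<and> t = 0"
      using st by (cases "s < 1"; cases "t < 1") auto
  qed
  ultimately have "simple_path g" by (simp add: simple_path_def)
  moreover have "pathfinish g = pathstart g"
    by (simp add: pathfinish_def pathstart_def g_def ends)
  moreover have "path_image g = tangle_of r (set ks)"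
  proof (intro equalityI subsetI)
    fix p assume "p \<in> path_image g"
    then obtain t where p: "p = curve t" by (auto simp: path_image_def g_def)
    have "p \<in> arc_of r (K \<lfloor>t\<rfloor>)"
      unfolding p curve_def cell_path_image[symmetric] by (intro imageI) (auto, linarith)
    then show "p \<in> tangle_of r (set ks)" using K_in by (auto simp: tangle_of_def)
  next
    fix p assume "p \<in> tangle_of r (set ks)"
    then obtain j where j: "j < n" "p \<in> arc_of r (ks ! j)"
      by (auto simp: tangle_of_def in_set_conv_nth n_def)
    then obtain s where s: "0 \<le> s" "s \<le> 1" "p = cell_path r (K (int j)) s"
      by (auto simp: K_def simp flip: cell_path_image)
    have "p = curve (real j + s)"
      using s curve_eq(1)[of "int j" "real j + s"] by simp
    then have "p = g ((real j + s) / real n)" using n by (simp add: g_def)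
    moreover have "(real j + s) / real n \<in> {0..1}" using j s n by (auto simp: field_simps)
    ultimately show "p \<in> path_image g" by (auto simp: path_image_def)
  qed
  moreover have "g C1_differentiable_on {0..1}"
    unfolding C1_differentiable_on_def
  proof (intro exI conjI ballI)
    show "(g has_vector_derivative (real n * curve' (real n * t))) (at t)" for t by (rule g')
    show "continuous_on {0..1} (\<lambda>t. real n * curve' (real n * t))"
      by (intro continuous_intros continuous_on_compose2[OF curve'_continuous]) auto
  qed
  moreover have "vector_derivative g (at t) = real n * curve' (real n * t)" for t
    using g' by (rule vector_derivative_at)
  ultimately show ?thesis
    unfolding smooth_simple_closed_curve_def using n curve'_nonzero ends
    by (intro exI[of _ g]) auto
qed

section \<open>Smooth curves made of links are directed cycles\<close>

lemma eventually_at_left_less: "\<forall>\<^sub>F s in at_left t. s < (t::real)"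
  by (simp add: eventually_at_filter)

lemma derivative_right_nonneg:
  fixes f :: "real \<Rightarrow> real"
  assumes "(f has_real_derivative a) (at t)" "\<forall>\<^sub>F s in at_right t. f t \<le> f s"
  shows "0 \<le> a"
proof -
  have "((\<lambda>s. (f s - f t) / (s - t)) \<longlongrightarrow> a) (at_right t)"
    using has_field_derivative_at_within[OF assms(1)] by (simp add: has_field_derivative_iff)
  moreover have "\<forall>\<^sub>F s in at_right t. 0 \<le> (f s - f t) / (s - t)"
    using assms(2) eventually_at_right_less[of t] by eventually_elim auto
  ultimately show ?thesis by (rule tendsto_lowerbound) simp
qed

lemma derivative_left_nonpos:
  fixes f :: "real \<Rightarrow> real"
  assumes "(f has_real_derivative a) (at t)" "\<forall>\<^sub>F s in at_left t. f t \<le> f s"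
  shows "a \<le> 0"
proof -
  have "((\<lambda>s. (f s - f t) / (s - t)) \<longlongrightarrow> a) (at_left t)"
    using has_field_derivative_at_within[OF assms(1)] by (simp add: has_field_derivative_iff)
  moreover have "\<forall>\<^sub>F s in at_left t. (f s - f t) / (s - t) \<le> 0"
    using assms(2) eventually_at_left_less
    by eventually_elim (auto intro: divide_nonneg_neg)
  ultimately show ?thesis by (rule tendsto_upperbound) simp
qed

text \<open>The quotient of \<open>h\<close> is at most a convergent quotient of \<open>f\<close>
  times a difference of \<open>f\<close> that tends to 0. For a curve that leaves a line only
  quadratically, this kills the velocity across the line.\<close>

lemma derivative_quadratic_zero:
  fixes f h :: "real \<Rightarrow> real"
  assumes "(f has_real_derivative a) (at t)" "(h has_real_derivative b) (at t)"
    "\<forall>\<^sub>F s in at_right t. \<bar>h s - h t\<bar> \<le> C * (f s - f t)\<^sup>2"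
  shows "b = 0"
proof -
  have f: "((\<lambda>s. (f s - f t) / (s - t)) \<longlongrightarrow> a) (at_right t)"
    using has_field_derivative_at_within[OF assms(1)] by (simp add: has_field_derivative_iff)
  have h: "((\<lambda>s. (h s - h t) / (s - t)) \<longlongrightarrow> b) (at_right t)"
    using has_field_derivative_at_within[OF assms(2)] by (simp add: has_field_derivative_iff)
  have "(f \<longlongrightarrow> f t) (at_right t)"
    using DERIV_isCont[OF assms(1)] by (auto simp: isCont_def intro: tendsto_within_subset)
  then have "((\<lambda>s. C * ((f s - f t) * \<bar>(f s - f t) / (s - t)\<bar>)) \<longlongrightarrow> C * ((f t - f t) * \<bar>a\<bar>)) (at_right t)"
    by (intro tendsto_intros f)
  then have lim: "((\<lambda>s. \<bar>C * ((f s - f t) * \<bar>(f s - f t) / (s - t)\<bar>)\<bar>) \<longlongrightarrow> 0) (at_right t)"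
    by (intro tendsto_rabs_zero) simp
  have "((\<lambda>s. (h s - h t) / (s - t)) \<longlongrightarrow> 0) (at_right t)"
  proof (rule Lim_null_comparison[OF _ lim])
    show "\<forall>\<^sub>F s in at_right t. norm ((h s - h t) / (s - t)) \<le> \<bar>C * ((f s - f t) * \<bar>(f s - f t) / (s - t)\<bar>)\<bar>"
      using assms(3) eventually_at_right_less[of t]
    proof eventually_elim
      case (elim s)
      have "\<bar>h s - h t\<bar> \<le> \<bar>C\<bar> * (f s - f t)\<^sup>2"
        using elim(1) by (rule order_trans) (intro mult_right_mono, auto)
      then have "\<bar>h s - h t\<bar> / (s - t) \<le> \<bar>C\<bar> * (f s - f t)\<^sup>2 / (s - t)"
        using elim by (intro divide_right_mono) auto
      then show ?case using elim by (simp add: abs_mult power2_eq_square)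
    qed
  qed
  then show ?thesis using h tendsto_unique by (metis trivial_limit_at_right_real)
qed

lemma src_tgt_flip_neq [simp]: "src (tgt_flip k) \<noteq> tgt k" "tgt (src_flip k) \<noteq> src k"
  by (metis src_neq_tgt(1) tgt_tgt_flip, metis src_neq_tgt(2) src_src_flip)

text \<open>All links entering a tangency point, and likewise all links leaving it, lie on the same side of it and are
  tangent there to the same line. Hence two of them form a cusp, where the derivative of a
  \<open>C\<^sup>1\<close> parametrization would vanish. In the lemma \<open>l0\<close> is a fixed one of the two links, so that the
  conclusion is the same for both.\<close>

lemma cell_cusp:
  assumes r: "r > 0" and z: "z \<in> open_cell r l" "z \<in> arc_of r l" and l: "src l = x \<and>
    l0 \<in> {l, src_flip l} \<or> tgt l = x \<and> l0 \<in> {l, tgt_flip l}"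
  shows "if (even_tile l0 \<longleftrightarrow> src l0 = x)
    then 0 \<le> cell_sign (snd l0) * (Im z - Im (grid_point r x)) \<and>
      \<bar>Re z - Re (grid_point r x)\<bar> \<le> (1/r) * (Im z - Im (grid_point r x))\<^sup>2
    else 0 \<le> cell_sign (fst l0) * (Re z - Re (grid_point r x)) \<and>
      \<bar>Im z - Im (grid_point r x)\<bar> \<le> (1/r) * (Re z - Re (grid_point r x))\<^sup>2"
proof -
  obtain u v where zuv: "z = cell_point r l u v" and uv: "0 < u" "u < 1" "0 < v" "v < 1"
    using z(1) unfolding open_cell_def by blast
  have one: "u\<^sup>2 + v\<^sup>2 = 1" using cell_point_in_arc_iff(1)[OF r, of u v l l] uv z(2) zuv by simp
  have "u\<^sup>2 \<le> u" "v\<^sup>2 \<le> v" using uv by (simp_all add: power2_eq_square mult_left_le_one_le)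
  \<comment> \<open>At an end of the link the distance from the tangent line is \<open>1 - u\<close>
    or \<open>1 - v\<close>, hence at most the square of the other coordinate; the factor
    \<open>1/r\<close> in the claim accounts for the scaling.\<close>
  then have b: "1 - u \<le> v\<^sup>2" "1 - v \<le> u\<^sup>2" using one by linarith+
  have even_tile: "even_tile l0 \<longleftrightarrow> even_tile l" using l by auto
  have src: "src l0 = x \<longleftrightarrow> src l = x" using l by auto
  have coord: "coord a 1 - coord a u = cell_sign a * (1 - u)"
    "coord a u - coord a 1 = - (cell_sign a * (1 - u))"
     "coord a u - coord a 0 = cell_sign a * u" for a u by (auto simp: coord_def cell_sign_def)
  have sgsq: "cell_sign a * (cell_sign a * y) = y" "cell_sign a * (c * (cell_sign a * y)) = c * y"
    "\<bar>cell_sign a\<bar> = 1" for a c y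
    by (auto simp: cell_sign_def)
  have A: ?thesis if "even_tile l \<longleftrightarrow> src l = x"
  proof -
    have x: "grid_point r x = cell_point r l 1 0"
      using l that cell_point_ends(3,6)[of l r] by auto
    have "snd l0 = snd l"
      using l that even_tile by (cases l) (auto simp: src_flip.simps tgt_flip.simps)
    then show ?thesis
      using b uv r that unfolding even_tile src x zuv cell_point_def
      by (auto simp: coord sgsq abs_mult power_mult_distrib power2_eq_square simp flip: right_diff_distrib)
  qed
  have B: ?thesis if "\<not> (even_tile l \<longleftrightarrow> src l = x)"
  proof -
    have x: "grid_point r x = cell_point r l 0 1"
      using l that cell_point_ends(4,5)[of l r] by auto
    have "fst l0 = fst l"
      using l that even_tile by (cases l) (auto simp: src_flip.simps tgt_flip.simps)
    then show ?thesis
      using b uv r that unfolding even_tile src x zuv cell_point_def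
      by (auto simp: coord sgsq abs_mult power_mult_distrib power2_eq_square simp flip: right_diff_distrib)
  qed
  show ?thesis using A B by blast
qed

section \<open>The curve near a tangency point\<close>

lemma closed_arc_of: "closed (arc_of r k)"
proof -
  have "continuous_on {0..1} (cell_path r k)"
    using cell_path_has_derivative by (meson continuous_on_eq_continuous_within has_vector_derivative_continuous)
  then show ?thesis
    by (metis compact_Icc compact_continuous_image compact_imp_closed cell_path_image)
qed

lemma node_notin_cell:
  assumes "r > 0" "x \<in> {src k, tgt k}"
  shows "grid_point r x \<notin> open_cell r l"
  using node_notin_open_cell[OF assms(1)] assms(2) by blast

lemma node_in_arc_iff:
  assumes r: "r > 0" and x: "x \<in> {src k, tgt k}"
  shows "grid_point r x \<in> arc_of r l \<longleftrightarrow> x \<in> {src l, tgt l}"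
proof
  assume "grid_point r x \<in> arc_of r l"
  then show "x \<in> {src l, tgt l}"
    by (rule arcs_meet[OF r]) (use node_notin_cell[OF r x] grid_point_inj[OF r] in auto)
qed (use ends_in_arc[OF r, of l] in auto)

text \<open>The links of \<open>K\<close> that do not end at \<open>x\<close>, together with the
  other nodes, form a closed set since \<open>K\<close> is finite, and the node is not in
  it.\<close>

lemma tangle_of_near_node:
  assumes r: "r > 0" and fin: "finite K" and x: "x \<in> {src k, tgt k}"
  obtains \<delta> where "\<delta> > 0"
    "\<And>q. q \<in> tangle_of r K \<Longrightarrow> q \<in> ball (grid_point r x) \<delta> \<Longrightarrow> q \<noteq> grid_point r x \<Longrightarrow>
      \<exists>l\<in>K. x \<in> {src l, tgt l} \<and> q \<in> open_cell r l \<and> q \<in> arc_of r l"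
proof -
  let ?L = "{l \<in> K. x \<notin> {src l, tgt l}}"
  let ?F = "(\<Union>l\<in>?L. arc_of r l) \<union> (grid_point r ` (src ` K \<union> tgt ` K) - {grid_point r x})"
  have "closed ?F"
    using fin by (intro closed_Un closed_UN finite_imp_closed) (auto simp: closed_arc_of)
  moreover have "grid_point r x \<in> - ?F" using node_in_arc_iff[OF r x] by blast
  ultimately obtain \<delta> where d: "\<delta> > 0" "ball (grid_point r x) \<delta> \<subseteq> - ?F"
    by (meson open_Compl open_contains_ball)
  show ?thesis
  proof (rule that[OF d(1)])
    fix q assume q: "q \<in> tangle_of r K" "q \<in> ball (grid_point r x) \<delta>" "q \<noteq> grid_point r x"
    then obtain l where l: "l \<in> K" "q \<in> arc_of r l" by (auto simp: tangle_of_def)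
    have nF: "q \<notin> ?F" using q d by blast
    then have "x \<in> {src l, tgt l}" using l by blast
    moreover have "q \<in> open_cell r l"
      by (rule arcs_meet[OF r l(2)]) (use nF q(3) l(1) in blast)+
    ultimately show "\<exists>l\<in>K. x \<in> {src l, tgt l} \<and> q \<in> open_cell r l \<and> q \<in> arc_of r l"
      using l by blast
  qed
qed

lemma open_cells_disjoint:
  assumes "r > 0" "q \<in> open_cell r k" "q \<in> open_cell r l"
  shows "l = k"
proof -
  obtain u v where q: "q = cell_point r k u v" and uv: "0 < u" "u < 1" "0 < v" "v < 1"
    using assms(2) unfolding open_cell_def by blast
  obtain u' v' where "q = cell_point r l u' v'" "0 < u'" "u' < 1" "0 < v'" "v' < 1"
    using assms(3) unfolding open_cell_def by blast
  then show ?thesis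
    using cell_point_eqD(3)[of r k u v l u' v'] q uv assms(1) by simp
qed

lemma connected_in_open_cell:
  assumes r: "r > 0" and C: "connected C" "C \<noteq> {}" and cov: "\<And>q. q \<in> C \<Longrightarrow> \<exists>l\<in>M. q \<in> open_cell r l"
  obtains l where "l \<in> M" "C \<subseteq> open_cell r l"
proof -
  obtain q l where l: "q \<in> C" "l \<in> M" "q \<in> open_cell r l" using C(2) cov by blast
  let ?B = "\<Union>k\<in>M - {l}. open_cell r k"
  have "open_cell r l \<inter> C = {} \<or> ?B \<inter> C = {}"
  proof (rule connectedD[OF C(1)])
    show "open (open_cell r l)" "open ?B" using open_open_cell[OF r] by auto
    show "open_cell r l \<inter> ?B \<inter> C = {}" using open_cells_disjoint[OF r] by blast
    show "C \<subseteq> open_cell r l \<union> ?B" using cov by blast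
  qed
  then have "C \<subseteq> open_cell r l" using l cov by blast
  then show ?thesis using that l by blast
qed

lemma arc_end_closure:
  assumes r: "r > 0" and x: "x \<in> {src k, tgt k}"
  shows "grid_point r x \<in> closure (arc_of r k \<inter> open_cell r k)"
proof -
  have "cell_path r k ` {0<..<1} \<subseteq> closure (arc_of r k \<inter> open_cell r k)"
  proof (clarify)
    fix t :: real assume t: "t \<in> {0<..<1}"
    then have arc: "cell_path r k t \<in> arc_of r k" unfolding cell_path_image[symmetric] by auto
    have "cell_path r k t \<noteq> grid_point r (src k)" "cell_path r k t \<noteq> grid_point r (tgt k)"
      using cell_path_inj[OF r, of t 0 k] cell_path_inj[OF r, of t 1 k] t by
        (auto simp: cell_path_ends)
    then have "cell_path r k t \<in> open_cell r k" by (rule_tac arcs_meet[OF r arc]) simp_all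
    then show "cell_path r k t \<in> closure (arc_of r k \<inter> open_cell r k)"
      using arc subsetD[OF closure_subset] by (metis IntI)
  qed
  moreover have "continuous_on (closure {0<..<1}) (cell_path r k)"
    using cell_path_has_derivative by (meson continuous_on_eq_continuous_within has_vector_derivative_continuous)
  ultimately have "cell_path r k ` closure {0<..<1} \<subseteq> closure (arc_of r k \<inter> open_cell r k)"
    by (intro image_closure_subset) auto
  moreover have "grid_point r x \<in> cell_path r k ` closure {0<..<1}"
    using x by (auto simp: closure_greaterThanLessThan simp flip: cell_path_ends)
  ultimately show ?thesis by blast
qed

text \<open>Just after and just before the node the curve runs inside disjoint open cells, so by
  connectedness it departs along one link \<open>l1\<close> and arrives along one link
  \<open>l2\<close>. A third link is excluded by compactness, and equal roles of \<open>l1\<close>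
  and \<open>l2\<close> by the cusp argument.\<close>

lemma tangle_node_aux:
  assumes r: "r > 0" and fin: "finite K" and x: "x \<in> {src k, tgt k}" and k: "k \<in> K"
    and g: "simple_path g" "pathfinish g = pathstart g" "path_image g = tangle_of r K"
    and g': "\<And>t. t \<in> {0..1} \<Longrightarrow> (g has_vector_derivative D t) (at t)" "\<And>t. t \<in> {0..1} \<Longrightarrow> D t \<noteq> 0"
      "D 0 = D 1"
  obtains l l' where "l \<in> K" "l' \<in> K" "src l = x" "tgt l' = x"
    "\<And>m. m \<in> K \<Longrightarrow> x \<in> {src m, tgt m} \<Longrightarrow> m = l \<or> m = l'"
proof -
  let ?p = "grid_point r x"
  have "?p \<in> tangle_of r K" using ends_in_arc[OF r, of k] k x by (auto simp: tangle_of_def)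
  then obtain t0 where t0: "t0 \<in> {0..1}" "g t0 = ?p" unfolding g(3)[symmetric] by
    (auto simp: path_image_def)
  have loop: "s = t \<or> s = 0 \<and> t = 1 \<or> s = 1 \<and> t = 0" if "s \<in> {0..1}" "t \<in> {0..1}" "g s = g t"
    for s t
    using g(1) that by (auto simp: simple_path_def loop_free_def)
  have g01: "g 0 = g 1" using g(2) by (simp add: pathstart_def pathfinish_def)
  \<comment> \<open>The curve departs from the node at time \<open>t1\<close> and arrives at time
    \<open>t2\<close>; the two differ only if the node is the base point of the loop.\<close>
  obtain t1 t2 where t12: "0 \<le> t1" "t1 < 1" "0 < t2" "t2 \<le> 1" "g t1 = ?p" "g t2 = ?p" "D t1 = D t2"
    and t12': "t1 = t2 \<or> t1 = 0 \<and> t2 = 1"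
  proof (cases "t0 = 0 \<or> t0 = 1")
    case True
    then show ?thesis using that[of 0 1] t0 g01 g'(3) by auto
  next
    case False
    then show ?thesis using that[of t0 t0] t0 by auto
  qed
  have cont: "continuous_on {0..1} g" using g(1) by (simp add: simple_path_def path_def)
  obtain \<delta> where d: "\<delta> > 0" "\<And>q. q \<in> tangle_of r K \<Longrightarrow> q \<in> ball ?p \<delta> \<Longrightarrow> q \<noteq> ?p \<Longrightarrow>
      \<exists>l\<in>K. x \<in> {src l, tgt l} \<and> q \<in> open_cell r l \<and> q \<in> arc_of r l"
    using tangle_of_near_node[OF r fin x] by blast
  have near: "\<exists>e>0. \<forall>s\<in>{0..1}. dist s t < e \<longrightarrow> g s \<in> ball ?p \<delta>" if "t \<in> {0..1}" "g t = ?p" for t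
    using cont that d(1) unfolding continuous_on_iff by (metis dist_commute mem_ball)
  obtain e1 where e1: "e1 > 0" "\<And>s. s \<in> {0..1} \<Longrightarrow> dist s t1 < e1 \<Longrightarrow> g s \<in> ball ?p \<delta>"
    using near[of t1] t12 by auto
  obtain e2 where e2: "e2 > 0" "\<And>s. s \<in> {0..1} \<Longrightarrow> dist s t2 < e2 \<Longrightarrow> g s \<in> ball ?p \<delta>"
    using near[of t2] t12 by auto
  define e where "e = Min {e1, e2, 1 - t1, t2}"
  have e: "e > 0" "e \<le> e1" "e \<le> e2" "t1 + e \<le> 1" "0 \<le> t2 - e"
    using e1(1) e2(1) t12 by (auto simp: e_def min_def)
  have ne: "g s \<noteq> ?p" if "s \<in> {t1<..<t1 + e} \<union> {t2 - e<..<t2}" for s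
    using loop[of s t1] loop[of s t2] t12 t12' that e by auto
  let ?M = "{l \<in> K. x \<in> {src l, tgt l}}"
  have cell: "\<exists>l\<in>?M. q \<in> open_cell r l" if q: "q \<in> g ` {t1<..<t1 + e} \<union> g ` {t2 - e<..<t2}" for q
  proof -
    obtain s where s: "q = g s" "s \<in> {t1<..<t1 + e} \<union> {t2 - e<..<t2}" using q by auto
    then have s01: "s \<in> {0..1}" using t12 e by auto
    have "q \<in> tangle_of r K" unfolding g(3)[symmetric] using s01 s by (auto simp: path_image_def)
    moreover have "q \<in> ball ?p \<delta>"
      using s e1(2)[OF s01] e2(2)[OF s01] e by (auto simp: dist_real_def)
    ultimately show ?thesis using d(2)[of q] ne[OF s(2)] s(1) by auto
  qed
  have con: "connected (g ` S)" if "connected S" "S \<subseteq> {0..1}" for S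
    using connected_continuous_image continuous_on_subset[OF cont] that by blast
  obtain l1 where l1: "l1 \<in> ?M" "g ` {t1<..<t1 + e} \<subseteq> open_cell r l1"
    by (rule connected_in_open_cell[OF r con[of "{t1<..<t1 + e}"], of ?M]) (use t12 e cell in auto)
  obtain l2 where l2: "l2 \<in> ?M" "g ` {t2 - e<..<t2} \<subseteq> open_cell r l2"
    by (rule connected_in_open_cell[OF r con[of "{t2 - e<..<t2}"], of ?M]) (use t12 e cell in auto)
  have only: "m = l1 \<or> m = l2" if m: "m \<in> K" "x \<in> {src m, tgt m}" for m
  proof -
    \<comment> \<open>Away from these parameters the curve keeps a positive distance from the node,
      so points of \<open>m\<close> close to the node are reached at parameters in
      \<open>?U\<close>.\<close>
    let ?U = "{t1 - e<..<t1 + e} \<union> {t2 - e<..<t2 + e}"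
    have "compact ({0..1} - ?U)" by (intro compact_diff) auto
    then have "compact (g ` ({0..1} - ?U))"
      by (rule compact_continuous_image[OF continuous_on_subset[OF cont], rotated]) auto
    moreover have "?p \<notin> g ` ({0..1} - ?U)"
      using loop[of _ t1] loop[of _ t2] t12 t12' e(1) by fastforce
    ultimately obtain \<eta> where eta: "\<eta> > 0" "ball ?p \<eta> \<subseteq> - g ` ({0..1} - ?U)"
      by (meson ComplI compact_imp_closed open_Compl open_contains_ball)
    obtain z where z: "z \<in> arc_of r m" "z \<in> open_cell r m" "z \<in> ball ?p \<eta>"
      using arc_end_closure[OF r m(2)] eta(1) unfolding closure_approachable
      by (metis IntE dist_commute mem_ball)
    then have "z \<in> path_image g" using m(1) g(3) by (auto simp: tangle_of_def)
    then obtain s where s: "s \<in> {0..1}" "z = g s" by (auto simp: path_image_def)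
    have "s \<in> ?U"
    proof (rule ccontr)
      assume "s \<notin> ?U"
      then have "g s \<in> g ` ({0..1} - ?U)" using s(1) by blast
      then show False using z(3) s(2) eta(2) by blast
    qed
    moreover have "z \<noteq> ?p" using z(2) node_notin_cell[OF r m(2)] by blast
    ultimately have "s \<in> {t1<..<t1 + e} \<union> {t2 - e<..<t2}"
      using s t12 t12' by (cases "s = t1"; cases "s = t2") auto
    then have "z \<in> open_cell r l1 \<or> z \<in> open_cell r l2" using l1(2) l2(2) s(2) by blast
    then show ?thesis using open_cells_disjoint[OF r z(2)] by blast
  qed
  have in_arc: "g s \<in> arc_of r l" if "g s \<in> open_cell r l" "s \<in> {0..1}" for s l
  proof -
    have "g s \<in> tangle_of r K" using that(2) unfolding g(3)[symmetric] by
      (auto simp: path_image_def)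
    then show ?thesis using open_cell_arc[OF r that(1)] by (auto simp: tangle_of_def)
  qed
  have False if same: "src l1 = x \<and> src l2 = x \<or> tgt l1 = x \<and> tgt l2 = x"
  proof -
    have l12: "src l1 = x \<and> l1 \<in> {l1, src_flip l1} \<or> tgt l1 = x \<and> l1 \<in> {l1, tgt_flip l1}"
      "src l2 = x \<and> l1 \<in> {l2, src_flip l2} \<or> tgt l2 = x \<and> l1 \<in> {l2, tgt_flip l2}"
      using same src_eq_iff[of l2 l1] tgt_eq_iff[of l2 l1] by auto
    have ev1: "\<forall>\<^sub>F s in at_right t1. g s \<in> open_cell r l1 \<and> g s \<in> arc_of r l1"
    proof (rule eventually_at_rightI[of t1 "t1 + e"])
      fix s assume s: "s \<in> {t1<..<t1 + e}"
      then have "g s \<in> open_cell r l1" "s \<in> {0..1}" using l1(2) t12 e by auto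
      then show "g s \<in> open_cell r l1 \<and> g s \<in> arc_of r l1" using in_arc by blast
    qed (use e in simp)
    have ev2: "\<forall>\<^sub>F s in at_left t2. g s \<in> open_cell r l2 \<and> g s \<in> arc_of r l2"
    proof (rule eventually_at_leftI[of "t2 - e" t2])
      fix s assume s: "s \<in> {t2 - e<..<t2}"
      then have "g s \<in> open_cell r l2" "s \<in> {0..1}" using l2(2) t12 e by auto
      then show "g s \<in> open_cell r l2 \<and> g s \<in> arc_of r l2" using in_arc by blast
    qed (use e in simp)
    have D1: "(g has_vector_derivative D t1) (at t1)" "(g has_vector_derivative D t1) (at t2)"
      using g'(1)[of t1] g'(1)[of t2] t12 by auto
    have Re: "((\<lambda>s. Re (g s)) has_real_derivative Re (D t1)) (at t1)"
      "((\<lambda>s. Re (g s)) has_real_derivative Re (D t1)) (at t2)"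
      and Im: "((\<lambda>s. Im (g s)) has_real_derivative Im (D t1)) (at t1)"
      "((\<lambda>s. Im (g s)) has_real_derivative Im (D t1)) (at t2)"
      using D1 unfolding has_vector_derivative_complex_iff by auto
    \<comment> \<open>Along the tangent the velocity is nonnegative on departure and nonpositive on
      arrival from the same side; across it the quadratic bound applies. The cases are a vertical
      and a horizontal tangent.\<close>
    have "D t1 = 0"
    proof (cases "even_tile l1 \<longleftrightarrow> src l1 = x")
      case True
      have 1: "\<forall>\<^sub>F s in at_right t1. cell_sign (snd l1) * Im (g t1) \<le> cell_sign (snd l1) * Im (g s)"
        "\<forall>\<^sub>F s in at_right t1. \<bar>Re (g s) - Re (g t1)\<bar> \<le> (1/r) * (Im (g s) - Im (g t1))\<^sup>2"
        by (rule eventually_mono[OF ev1],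
            use cell_cusp[OF r _ _ l12(1), unfolded if_P[OF True]]
              in \<open>simp add: t12(5) right_diff_distrib\<close>)+
      have 2: "\<forall>\<^sub>F s in at_left t2. cell_sign (snd l1) * Im (g t2) \<le> cell_sign (snd l1) * Im (g s)"
        by (rule eventually_mono[OF ev2],
            use cell_cusp[OF r _ _ l12(2), unfolded if_P[OF True]]
              in \<open>simp add: t12(6) right_diff_distrib\<close>)
      have "Re (D t1) = 0" by (rule derivative_quadratic_zero[OF Im(1) Re(1) 1(2)])
      moreover have "0 \<le> cell_sign (snd l1) * Im (D t1)"
        by (rule derivative_right_nonneg[OF DERIV_cmult[OF Im(1)] 1(1)])
      moreover have "cell_sign (snd l1) * Im (D t1) \<le> 0"
        by (rule derivative_left_nonpos[OF DERIV_cmult[OF Im(2)] 2])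
      ultimately show ?thesis by (auto simp: complex_eq_iff cell_sign_def split: if_splits)
    next
      case False
      have 1: "\<forall>\<^sub>F s in at_right t1. cell_sign (fst l1) * Re (g t1) \<le> cell_sign (fst l1) * Re (g s)"
        "\<forall>\<^sub>F s in at_right t1. \<bar>Im (g s) - Im (g t1)\<bar> \<le> (1/r) * (Re (g s) - Re (g t1))\<^sup>2"
        by (rule eventually_mono[OF ev1],
            use cell_cusp[OF r _ _ l12(1), unfolded if_not_P[OF False]]
              in \<open>simp add: t12(5) right_diff_distrib\<close>)+
      have 2: "\<forall>\<^sub>F s in at_left t2. cell_sign (fst l1) * Re (g t2) \<le> cell_sign (fst l1) * Re (g s)"
        by (rule eventually_mono[OF ev2],
            use cell_cusp[OF r _ _ l12(2), unfolded if_not_P[OF False]]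
              in \<open>simp add: t12(6) right_diff_distrib\<close>)
      have "Im (D t1) = 0" by (rule derivative_quadratic_zero[OF Re(1) Im(1) 1(2)])
      moreover have "0 \<le> cell_sign (fst l1) * Re (D t1)"
        by (rule derivative_right_nonneg[OF DERIV_cmult[OF Re(1)] 1(1)])
      moreover have "cell_sign (fst l1) * Re (D t1) \<le> 0"
        by (rule derivative_left_nonpos[OF DERIV_cmult[OF Re(2)] 2])
      ultimately show ?thesis by (auto simp: complex_eq_iff cell_sign_def split: if_splits)
    qed
    then show False using g'(2)[of t1] t12 by simp
  qed
  then have "src l1 = x \<and> tgt l2 = x \<or> tgt l1 = x \<and> src l2 = x"
    using l1(1) l2(1) by auto
  then show ?thesis
    using that[of l1 l2] that[of l2 l1] only l1(1) l2(1) by auto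
qed

lemma tangle_node:
  assumes r: "r > 0" and fin: "finite K" and smooth: "smooth_simple_closed_curve (tangle_of r K)"
  shows "inj_on src K" "inj_on tgt K" "src ` K = tgt ` K"
proof -
  obtain g where g: "simple_path g" "pathfinish g = pathstart g" "path_image g = tangle_of r K"
    and C1: "g C1_differentiable_on {0..1}" and ne: "\<forall>t\<in>{0..1}. vector_derivative g (at t) \<noteq> 0"
    and eq: "vector_derivative g (at 0) = vector_derivative g (at 1)"
    using smooth unfolding smooth_simple_closed_curve_def by blast
  have deriv: "(g has_vector_derivative vector_derivative g (at t)) (at t)" if "t \<in> {0..1}" for t
    using C1 that unfolding C1_differentiable_on_eq by (simp add: vector_derivative_works)
  have node: "\<exists>l l'. l \<in> K \<and> l' \<in> K \<and> src l = x \<and> tgt l' = x \<and>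
      (\<forall>m\<in>K. x \<in> {src m, tgt m} \<longrightarrow> m = l \<or> m = l')" if "k \<in> K" "x \<in> {src k, tgt k}" for k x
    by (rule tangle_node_aux[OF r fin that(2,1) g deriv _ eq]) (use ne in blast)+
  show "inj_on src K"
  proof (rule inj_onI)
    fix k m assume km: "k \<in> K" "m \<in> K" "src k = src m"
    obtain l l' where "tgt l' = src k" "\<forall>m\<in>K. src k \<in> {src m, tgt m} \<longrightarrow> m = l \<or> m = l'"
      using node[OF km(1), of "src k"] by blast
    moreover from this have "k \<noteq> l'" "m \<noteq> l'" using km(3) by (metis src_neq_tgt(1))+
    ultimately show "k = m" using km by (metis insertI1)
  qed
  show "inj_on tgt K"
  proof (rule inj_onI)
    fix k m assume km: "k \<in> K" "m \<in> K" "tgt k = tgt m"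
    obtain l l' where "src l = tgt k" "\<forall>m\<in>K. tgt k \<in> {src m, tgt m} \<longrightarrow> m = l \<or> m = l'"
      using node[OF km(1), of "tgt k"] by blast
    moreover from this have "k \<noteq> l" "m \<noteq> l" using km(3) by (metis src_neq_tgt(1))+
    ultimately show "k = m" using km by (metis insertI1 insertI2)
  qed
  have "src k \<in> tgt ` K" "tgt k \<in> src ` K" if "k \<in> K" for k
    using node[OF that, of "src k"] node[OF that, of "tgt k"] by (metis imageI insertCI)+
  then show "src ` K = tgt ` K" by blast
qed

text \<open>The link that continues a longest path already lies on it, and must be its first:
  otherwise its predecessor and the last link would be two links with the same target.\<close>

lemma cell_cycle_exists:
  assumes fin: "finite K" and "K \<noteq> {}" and inj: "inj_on src K"
    "inj_on tgt K" and eq: "src ` K = tgt ` K"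
  obtains ks where "cell_cycle ks" "set ks \<subseteq> K"
proof -
  define S where "S ks \<longleftrightarrow> ks \<noteq> [] \<and> distinct ks \<and> set ks \<subseteq> K \<and> successively (\<lambda>k l. tgt k = src l) ks"
    for ks
  obtain k0 where "k0 \<in> K" using assms by blast
  then have "S [k0]" by (simp add: S_def)
  moreover have "length ks \<le> card K" if "S ks" for ks
    using that fin by (metis S_def card_mono distinct_card)
  ultimately obtain ks where ks: "S ks" and max: "\<And>ls. S ls \<Longrightarrow> length ls \<le> length ks"
    using ex_has_greatest_nat[of S "[k0]" length "Suc (card K)"] by (metis less_Suc_eq_le)
  have "last ks \<in> K" using ks by (auto simp: S_def)
  then obtain l where l: "l \<in> K" "src l = tgt (last ks)" using eq by (metis imageE imageI)
  have "l \<in> set ks"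
  proof (rule ccontr)
    assume "l \<notin> set ks"
    then have "S (ks @ [l])" using ks l by (auto simp: S_def successively_append_iff)
    then show False using max by fastforce
  qed
  then obtain xs ys where xy: "ks = xs @ l # ys" by (meson split_list)
  have "xs = []"
  proof (rule ccontr)
    assume xs: "xs \<noteq> []"
    then have "tgt (last xs) = tgt (last ks)" using ks xy l by
      (auto simp: S_def successively_append_iff)
    then have "last xs = last ks" using inj(2) xs xy ks unfolding S_def
      by (metis UnCI \<open>last ks \<in> K\<close> inj_on_def last_in_set set_append subset_iff)
    moreover have "last ks \<in> set (l # ys)" using xy by auto
    moreover have "set xs \<inter> set (l # ys) = {}" using ks xy by (auto simp: S_def)
    ultimately show False using last_in_set[OF xs] by auto
  qed
  then have "hd ks = l" using xy by simp
  moreover have "inj_on src (set ks)" using ks inj(1) by (auto simp: S_def intro: inj_on_subset)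
  ultimately have "cell_cycle ks" using ks l unfolding S_def cell_cycle_def distinct_map by simp
  then show ?thesis using that ks by (auto simp: S_def)
qed

text \<open>At each node of a cycle in \<open>K\<close> both places are taken by links of the cycle,
  so the remaining links of \<open>K\<close> cannot touch it. Both parts are closed, and the curve
  is connected.\<close>

lemma square_tangle_cell_cycle:
  assumes r: "r > 0" and T: "square_tangle r T"
  obtains ks where "cell_cycle ks" "T = tangle_of r (set ks)"
proof -
  obtain K where smooth: "smooth_simple_closed_curve T" and K: "finite K" "T = tangle_of r K"
    using T square_tangle_tangle_of_iff[OF r] by blast
  obtain g where "simple_path g" "path_image g = T"
    using smooth_jordan[OF smooth] by (auto simp: jordan_def)
  then have conn: "connected (tangle_of r K)" "tangle_of r K \<noteq> {}"
    using connected_simple_path_image[of g] simple_path_imp_path[of g]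
      path_image_nonempty[of g] K(2) by simp_all
  then have "K \<noteq> {}" by (auto simp: tangle_of_def)
  note nodes = tangle_node[OF r K(1) smooth[unfolded K(2)]]
  obtain ks where ks: "cell_cycle ks" "set ks \<subseteq> K"
    using cell_cycle_exists[OF K(1) \<open>K \<noteq> {}\<close> nodes] .
  have ends: "src ` set ks = tgt ` set ks" using cell_cycle_distinct(3)[OF ks(1)] by simp
  have disj: "False" if kl: "k \<in> set ks" "l \<in> K - set ks" "p \<in> arc_of r k" "p \<in> arc_of r l"
    for k l p
  proof -
    have "k \<noteq> l" using kl by auto
    then obtain x where x: "x \<in> {src k, tgt k}" "x \<in> {src l, tgt l}"
      using arc_disjoint[OF r kl(3,4)] by metis
    have "x \<in> src ` set ks" "x \<in> tgt ` set ks" using x(1) kl(1) ends by blast+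
    then obtain k1 k2 where k12: "k1 \<in> set ks" "x = src k1" "k2 \<in> set ks" "x = tgt k2" by blast
    have "l = k1 \<or> l = k2"
      using x(2) k12 ks(2) kl(2) inj_onD[OF nodes(1), of l k1] inj_onD[OF nodes(2), of l k2] by blast
    then show False using k12 kl(2) by blast
  qed
  have "tangle_of r (set ks) \<inter> tangle_of r K = {} \<or> tangle_of r (K - set ks) \<inter> tangle_of r K = {}"
  proof (rule connected_closedD[OF conn(1)])
    show "tangle_of r (set ks) \<inter> tangle_of r (K - set ks) \<inter> tangle_of r K = {}"
      using disj unfolding tangle_of_def by blast
    show "tangle_of r K \<subseteq> tangle_of r (set ks) \<union> tangle_of r (K - set ks)"
      unfolding tangle_of_def by blast
    show "closed (tangle_of r (set ks))" "closed (tangle_of r (K - set ks))"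
      using K(1) unfolding tangle_of_def by (auto intro!: closed_UN simp: closed_arc_of)
  qed
  moreover have "hd ks \<in> set ks" using ks(1) by (simp add: cell_cycle_def)
  then have "grid_point r (src (hd ks)) \<in> tangle_of r (set ks) \<inter> tangle_of r K"
    using ks(2) ends_in_arc(1)[OF r, of "hd ks"] unfolding tangle_of_def by blast
  ultimately have empty: "tangle_of r (K - set ks) \<inter> tangle_of r K = {}" by blast
  have "K - set ks = {}"
  proof (rule ccontr)
    assume "K - set ks \<noteq> {}"
    then obtain l where "l \<in> K - set ks" by blast
    then have "grid_point r (src l) \<in> tangle_of r (K - set ks) \<inter> tangle_of r K"
      using ends_in_arc(1)[OF r, of l] unfolding tangle_of_def by blast
    then show False using empty by blast
  qed
  then have "set ks = K" using ks(2) by blast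
  then show ?thesis using that ks(1) K(2) by blast
qed

section \<open>Shears\<close>

lemma cell_cycle_square_tangle:
  assumes "r > 0" "cell_cycle ks"
  shows "square_tangle r (tangle_of r (set ks))" "jordan (tangle_of r (set ks))"
  using cell_cycle_smooth[OF assms] square_tangle_tangle_of_iff[OF assms(1)] smooth_jordan by blast+

text \<open>The outside of \<open>T\<close> is connected and misses \<open>T'\<close>, so it lies on
  one side of \<open>T'\<close>; being unbounded, it is not on the bounded side.\<close>

lemma inside_subset:
  assumes "jordan T" "jordan T'" "T' \<subseteq> T \<union> inside T"
  shows "inside T' \<subseteq> inside T \<union> T"
proof -
  note T = jordanD[OF assms(1)] and T' = jordanD[OF assms(2)]
  have "outside T \<inter> T' = {}" using assms(3) T(3,4) by blast
  then have "outside T \<subseteq> inside T' \<union> outside T'" using T'(4) by blast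
  moreover have "inside T' \<inter> outside T = {} \<or> outside T' \<inter> outside T = {}"
    by (rule connectedD[OF T(8) T'(1,2)]) (use T'(3) calculation in auto)
  moreover have "\<not> outside T \<subseteq> inside T'" using T(9) T'(7) bounded_subset by blast
  ultimately have *: "inside T' \<inter> outside T = {}" by blast
  show ?thesis
  proof
    fix p assume "p \<in> inside T'"
    then have "p \<notin> outside T" using * by (metis IntI emptyE)
    then show "p \<in> inside T \<union> T" using T(4) by (metis ComplI UnE UnI1 UnI2)
  qed
qed

lemma finite_pts_inside:
  assumes "r > 0" "bounded B"
  shows "finite {v. grid_point r v \<in> B}"
proof -
  obtain M where M: "\<And>z. z \<in> B \<Longrightarrow> norm z \<le> M" using assms(2) by (auto simp: bounded_iff)
  define N where "N = \<lceil>M / r\<rceil>"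
  have "v \<in> {-N..N} \<times> {-N..N}" if "grid_point r v \<in> B" for v
  proof -
    have "\<bar>x\<bar> \<le> N" if "\<bar>r * of_int x\<bar> \<le> M" for x :: int
    proof -
      have "of_int \<bar>x\<bar> * r \<le> M" using that assms(1) by (simp add: abs_mult mult.commute)
      then have "of_int \<bar>x\<bar> \<le> M / r" using assms(1) by (simp add: field_simps)
      then show ?thesis unfolding N_def by linarith
    qed
    moreover have "\<bar>r * of_int (fst v)\<bar> \<le> M" "\<bar>r * of_int (snd v)\<bar> \<le> M"
      using M[OF that] abs_Re_le_cmod[of "grid_point r v"] abs_Im_le_cmod[of "grid_point r v"] by
        (auto simp: grid_point_def)
    ultimately have "\<bar>fst v\<bar> \<le> N" "\<bar>snd v\<bar> \<le> N" by blast+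
    then show ?thesis by (cases v) auto
  qed
  then have "{v. grid_point r v \<in> B} \<subseteq> {-N..N} \<times> {-N..N}" by blast
  then show ?thesis by (rule finite_subset) simp
qed

text \<open>\<open>range center\<close> consists of the vertices of the tiling in units of
  \<open>r\<close>. The size of this set is the measure of the induction.\<close>

definition verts_inside :: "real \<Rightarrow> complex set \<Rightarrow> (int \<times> int) set" where
  "verts_inside r T = {v \<in> range center. grid_point r v \<in> inside T}"

text \<open>A link of the Tangle is convex exactly if its center has the parity
  \<open>\<sigma>\<close>.\<close>

definition inside_parity :: "real \<Rightarrow> cell list \<Rightarrow> bool \<Rightarrow> bool" where
  "inside_parity r ks \<sigma> \<longleftrightarrow> (\<forall>k\<in>set ks. grid_point r (center k) \<in> inside (tangle_of r (set ks)) \<longleftrightarrow>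
    (vertex_parity (center k) \<longleftrightarrow> \<sigma>))"

lemma inside_parity_exists:
  assumes "r > 0" "cell_cycle ks"
  obtains \<sigma> where "inside_parity r ks \<sigma>"
proof -
  obtain \<sigma> where "\<And>k. k \<in> set ks \<Longrightarrow>
      grid_point r (center k) \<in> inside (tangle_of r (set ks)) \<longleftrightarrow> (vertex_parity (center k) \<longleftrightarrow> \<sigma>)"
    by (rule sides_parity[OF assms(2) tangle_of_sides[OF assms(1) cell_cycle_square_tangle(2)[OF assms]]]) blast
  then have "inside_parity r ks \<sigma>" by (simp add: inside_parity_def)
  then show ?thesis by (rule that)
qed

text \<open>New links whose centers are enclosed stay in the closed region, so the region can only
  shrink. For the common link exactly one of center and tile center is enclosed by either curve; by
  the inclusion it is the same one, and so \<open>\<sigma>\<close> persists.\<close>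

lemma cell_cycle_grow:
  assumes r: "r > 0" and cyc: "cell_cycle ks" "cell_cycle ls" and \<sigma>: "inside_parity r ks \<sigma>"
    and new: "\<And>l. l \<in> set ls \<Longrightarrow> l \<notin> set ks \<Longrightarrow> grid_point r (center l) \<in> inside (tangle_of r (set ks))"
    and common: "k \<in> set ks" "k \<in> set ls"
  shows "inside_parity r ls \<sigma>" "verts_inside r (tangle_of r (set ls)) \<subseteq> verts_inside r (tangle_of r (set ks))"
proof -
  let ?T = "tangle_of r (set ks)" and ?T' = "tangle_of r (set ls)"
  note J = cell_cycle_square_tangle(2)[OF r cyc(1)] and J' = cell_cycle_square_tangle(2)[OF r cyc(2)]
  have "p \<in> ?T \<union> inside ?T" if p: "p \<in> ?T'" for p
  proof (cases "p \<in> ?T")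
    case False
    obtain l where l: "l \<in> set ls" "p \<in> arc_of r l" using p unfolding tangle_of_def by blast
    then have "l \<notin> set ks" using False unfolding tangle_of_def by blast
    then show ?thesis using arc_point_side[OF r J l(2) False] new[OF l(1)] by blast
  qed simp
  then have sub: "inside ?T' \<subseteq> inside ?T \<union> ?T" using inside_subset[OF J J'] by blast
  then have c: "grid_point r (center k) \<in> inside ?T' \<Longrightarrow> grid_point r (center k) \<in> inside ?T"
    and m: "grid_point r (tile_center k) \<in> inside ?T' \<Longrightarrow> grid_point r (tile_center k) \<in> inside ?T"
      for k
    using center_tile_center_notin_tangle_of[OF r] by blast+
  show "verts_inside r ?T' \<subseteq> verts_inside r ?T"
    using c by (auto simp: verts_inside_def)
  obtain \<sigma>' where \<sigma>': "inside_parity r ls \<sigma>'" using inside_parity_exists[OF r cyc(2)] .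
  have "\<sigma>' = \<sigma>"
    using \<sigma> \<sigma>' common c[of k] m[of k] tangle_of_used_cell[OF r J common(1)]
      tangle_of_used_cell[OF r J' common(2)]
    unfolding inside_parity_def by blast
  then show "inside_parity r ls \<sigma>" using \<sigma>' by simp
qed

section \<open>The exchange as an operation on links\<close>

lemma replaces_shear:
  assumes r: "r > 0" and cyc: "cell_cycle (xs @ [z])" "cell_cycle (xs @ shear z)"
  shows "replaces_links r (tangle_of r (set (xs @ [z]))) {link_of r z}
     (tangle_of r (set (xs @ shear z))) (link_of r ` set (shear z))"
    and "replaces_links r (tangle_of r (set (xs @ shear z))) (link_of r ` set (shear z))
     (tangle_of r (set (xs @ [z]))) {link_of r z}"
proof -
  have "z \<notin> set xs" "set xs \<inter> set (shear z) = {}"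
    using cell_cycle_distinct(2)[OF cyc(1)] cell_cycle_distinct(2)[OF cyc(2)] by auto
  then have "link_of r z \<notin> link_of r ` set xs" "link_of r ` set xs \<inter> link_of r ` set (shear z) = {}"
    using inj_link_of[OF r] by (auto simp: inj_image_mem_iff simp flip: image_Int)
  then show "replaces_links r (tangle_of r (set (xs @ [z]))) {link_of r z}
     (tangle_of r (set (xs @ shear z))) (link_of r ` set (shear z))"
    "replaces_links r (tangle_of r (set (xs @ shear z))) (link_of r ` set (shear z))
     (tangle_of r (set (xs @ [z]))) {link_of r z}"
    using cell_cycle_square_tangle(1)[OF r cyc(1)] cell_cycle_square_tangle(1)[OF r cyc(2)]
    unfolding replaces_links_def tangle_links_tangle_of[OF r] by auto
qed

lemma consecutive_shear:
  assumes r: "r > 0" and cyc: "cell_cycle (xs @ shear z)"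
  shows "consecutive_links r (grid_point r (src z)) (map (link_of r) (shear z)) (grid_point r (tgt z))"
proof -
  define p where "p i = (if i < 5 then grid_point r (src (shear z ! i)) else grid_point r (tgt z))"
    for i
  have "distinct (shear z)" using cell_cycle_distinct(2)[OF cyc] by simp
  then have "distinct (map (link_of r) (shear z))"
    using inj_on_subset[OF inj_link_of[OF r] subset_UNIV] by (simp add: distinct_map)
  moreover have "p 0 = grid_point r (src z)"
    "p (length (map (link_of r) (shear z))) = grid_point r (tgt z)"
    by (simp_all add: p_def shear_def)
  moreover have "link_ends r (map (link_of r) (shear z) ! i) = {p i, p (Suc i)}"
    if "i < length (map (link_of r) (shear z))" for i
  proof -
    have "i = 0 \<or> i = 1 \<or> i = 2 \<or> i = 3 \<or> i = 4" using that by (auto simp: shear_def)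
    then show ?thesis
      by (elim disjE) (auto simp: p_def shear_def link_ends_link_of tgt_turn3 numeral_eq_Suc)
  qed
  ultimately show ?thesis unfolding consecutive_links_def by blast
qed

lemma concave_link_iff:
  assumes "r > 0" "jordan (tangle_of r K)"
  shows "concave_link r (tangle_of r K) (link_of r k) \<longleftrightarrow> k \<in> K \<and>
    grid_point r (center k) \<notin> inside (tangle_of r K)"
proof -
  have "link_of r k \<in> tangle_links r (tangle_of r K) \<longleftrightarrow> k \<in> K"
    using inj_link_of[OF assms(1)] by (simp add: tangle_links_tangle_of[OF assms(1)] inj_image_mem_iff)
  then show ?thesis unfolding concave_link_def convex_link_iff[OF assms] by blast
qed

text \<open>In \<open>shear z\<close> the three middle links have the parity of \<open>z\<close> and
  the outer two the other parity. This gives the pattern of an insertion if \<open>z\<close> is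
  convex, and that of a reduction if \<open>z\<close> is concave.\<close>

lemma shear_step:
  assumes r: "r > 0" and cyc: "cell_cycle (xs @ [z])" "cell_cycle (xs @ shear z)"
    and \<sigma>: "inside_parity r (xs @ [z]) \<sigma>" "inside_parity r (xs @ shear z) \<sigma>"
  shows "vertex_parity (center z) = \<sigma> \<Longrightarrow> shear_insertion r (tangle_of r (set (xs @ [z]))) (tangle_of r (set (xs @ shear z)))"
    and "vertex_parity (center z) \<noteq> \<sigma> \<Longrightarrow> shear_reduction r (tangle_of r (set (xs @ shear z))) (tangle_of r (set (xs @ [z])))"
proof -
  let ?n = "turn (opposite z)"
  have set: "link_of r ` set (shear z) = {link_of r (src_flip z), link_of r ?n,
    link_of r (turn ?n), link_of r (turn (turn ?n)), link_of r (tgt_flip z)}"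
    "map (link_of r) (shear z) = [link_of r (src_flip z), link_of r ?n, link_of r (turn ?n),
      link_of r (turn (turn ?n)), link_of r (tgt_flip z)]"
    by (simp_all add: shear_def)
  note links = convex_link_iff[OF r cell_cycle_square_tangle(2)[OF r cyc(1)]]
    concave_link_iff[OF r cell_cycle_square_tangle(2)[OF r cyc(1)]]
    convex_link_iff[OF r cell_cycle_square_tangle(2)[OF r cyc(2)]]
    concave_link_iff[OF r cell_cycle_square_tangle(2)[OF r cyc(2)]]
  note reps = replaces_shear[OF r cyc, unfolded set] and cons = consecutive_shear[OF r cyc(2), unfolded set]
  have side1: "grid_point r (center z) \<in> inside (tangle_of r (set (xs @ [z]))) \<longleftrightarrow>
    vertex_parity (center z) = \<sigma>"
    using \<sigma>(1) by (simp add: inside_parity_def)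
  have side2: "grid_point r (center k) \<in> inside (tangle_of r (set (xs @ shear z))) \<longleftrightarrow>
    vertex_parity (center k) = \<sigma>"
    if "k \<in> set (shear z)" for k
    using \<sigma>(2) that by (simp add: inside_parity_def)
  have mem: "k \<in> set (shear z) \<Longrightarrow> k \<in> set (xs @ shear z)" for k by simp
  have shear: "src_flip z \<in> set (shear z)" "?n \<in> set (shear z)" "turn ?n \<in> set (shear z)"
    "turn (turn ?n) \<in> set (shear z)" "tgt_flip z \<in> set (shear z)"
    by (simp_all add: shear_def)
  note sides = side1 shear[THEN side2] shear[THEN mem]
  show "shear_insertion r (tangle_of r (set (xs @ [z]))) (tangle_of r (set (xs @ shear z)))"
    if "vertex_parity (center z) = \<sigma>"
    unfolding shear_insertion_def
    by (intro exI conjI, rule reps(1), rule link_ends_link_of, rule cons, unfold links)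
      (use that sides in auto)
  show "shear_reduction r (tangle_of r (set (xs @ shear z))) (tangle_of r (set (xs @ [z])))"
    if "vertex_parity (center z) \<noteq> \<sigma>"
    unfolding shear_reduction_def
    by (intro exI conjI, rule reps(2), rule link_ends_link_of, rule cons, unfold links)
      (use that sides in auto)
qed

section \<open>Undoing shears down to a circle\<close>

lemma constructible_step:
  assumes "constructible r T" "square_tangle r T'" "shear_insertion r T T' \<or> shear_reduction r T T'"
  shows "constructible r T'"
proof -
  obtain k :: nat and \<tau> where \<tau>: "\<forall>i\<le>k. square_tangle r (\<tau> i)"
    "\<exists>v\<in>tiling_vertices r. \<tau> 0 = sphere v r"
    "\<forall>i<k. shear_insertion r (\<tau> i) (\<tau> (Suc i)) \<or> shear_reduction r (\<tau> i) (\<tau> (Suc i))" "\<tau> k = T"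
    using assms(1) unfolding constructible_def by blast
  show ?thesis
    unfolding constructible_def
    by (rule exI[of _ "Suc k"], rule exI[of _ "\<tau>(Suc k := T')"]) (use \<tau> assms(2,3)
      in \<open>auto simp: less_Suc_eq le_Suc_eq\<close>)
qed

lemma tangle_of_center_eq_sphere:
  assumes "r > 0"
  shows "tangle_of r {m. center m = center k} = sphere (grid_point r (center k)) r"
proof (intro equalityI subsetI)
  fix p assume "p \<in> tangle_of r {m. center m = center k}"
  then obtain m u v where m: "center m = center k" "p = cell_point r m u v" "u\<^sup>2 + v\<^sup>2 = 1"
    by (auto simp: tangle_of_def arc_of_def)
  then show "p \<in> sphere (grid_point r (center k)) r"
    using dist_cell_point_center[OF assms, of m u v] by (simp add: dist_commute)
next
  fix p assume p: "p \<in> sphere (grid_point r (center k)) r"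
  obtain i j where ij: "center k = (2 * i, 2 * j)" by (cases k) (simp add: center.simps)
  define x y where "x = Re (p - grid_point r (center k)) / r"
    and "y = Im (p - grid_point r (center k)) / r"
  have "(cmod (p - grid_point r (center k)))\<^sup>2 = r\<^sup>2" using p by
    (simp add: dist_norm norm_minus_commute)
  then have xy: "x\<^sup>2 + y\<^sup>2 = 1"
    using assms by (simp add: x_def y_def cmod_power2 power_divide flip: add_divide_distrib)
  define a b where "a = (if 0 \<le> x then 2 * i else 2 * i - 1)" and "b = (if 0 \<le> y then 2 * j
    else 2 * j - 1)"
  have "center (a, b) = center k" by (auto simp: ij center.simps a_def b_def ceil_half_def)
  moreover have "p = cell_point r (a, b) \<bar>x\<bar> \<bar>y\<bar>"
    using assms by (auto simp: complex_eq_iff cell_point_def coord_def a_def b_def x_def y_def ij grid_point_def field_simps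
      zero_le_divide_iff)
  ultimately show "p \<in> tangle_of r {m. center m = center k}"
    using xy by (fastforce simp: tangle_of_def arc_of_def)
qed

text \<open>Passing to another circle changes the parity, so a cycle of a single parity never leaves
  its first circle.\<close>

lemma cell_cycle_convex_circle:
  assumes cyc: "cell_cycle ks" and par: "\<And>k. k \<in> set ks \<Longrightarrow> vertex_parity (center k) = \<sigma>"
  shows "set ks = {m. center m = center (hd ks)}"
proof -
  have step: "l = turn k" if "k \<in> set ks" "l \<in> set ks" "tgt k = src l" for k l
    using that(3) par[OF that(1)] par[OF that(2)] by (auto simp: tgt_src_iff)
  have turn: "turn k \<in> set ks" if "k \<in> set ks" for k
    using cell_cycle_next[OF cyc that] step[OF that] by metis
  have inv: "center l = center k" if "k \<in> set ks" "l \<in> set ks" "tgt k = src l" for k l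
    using step[OF that] by simp
  have "center k = center (hd ks)" if "k \<in> set ks" for k
    using successively_invariant[of "\<lambda>k l. tgt k = src l" ks center k] cyc that inv
    unfolding cell_cycle_def by blast
  moreover have "m \<in> set ks" if "center m = center (hd ks)" for m
  proof -
    have "hd ks \<in> set ks" using cyc by (simp add: cell_cycle_def)
    then show ?thesis using center_eq_iff[of "hd ks" m] that turn by metis
  qed
  ultimately show ?thesis by blast
qed

text \<open>With \<open>opposite z\<close> free, its vertex lies on the side of the tile center,
  which the concave \<open>z\<close> puts inside. A link of the curve leaving a node on the circle
  of that vertex would lie on the circle, hence be concave around an enclosed vertex, or be the flip
  of a free link of the circle, hence be convex around a vertex that is not enclosed.\<close>

lemma shear_open:
  assumes r: "r > 0" and cyc: "cell_cycle (xs @ [z])" and \<sigma>: "inside_parity r (xs @ [z]) \<sigma>"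
    and z: "vertex_parity (center z) \<noteq> \<sigma>" and opposite: "opposite z \<notin> set (xs @ [z])"
  shows "cell_cycle (xs @ shear z)" "grid_point r (center (opposite z)) \<in> inside (tangle_of r (set (xs @ [z])))"
proof -
  let ?K = "set (xs @ [z])"
  note J = cell_cycle_square_tangle(2)[OF r cyc]
  note used = tangle_of_used_cell[OF r J] and free = tangle_of_free_cell[OF r J]
  have zin: "z \<in> ?K" by simp
  show W: "grid_point r (center (opposite z)) \<in> inside (tangle_of r ?K)"
    using free[OF opposite] used[OF zin] \<sigma> z zin by (auto simp: inside_parity_def)
  have False if k: "center k = center (opposite z)" "m \<in> ?K" "src m = src k" for k m
  proof -
    have par: "vertex_parity (center k) \<noteq> \<sigma>" using k z by simp
    consider "m = k" | "m = src_flip k" using k(3) src_eq_iff[of k m] by metis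
    then show False
    proof cases
      case 1
      then show ?thesis using \<sigma> k W par unfolding inside_parity_def by metis
    next
      case 2
      then have "k \<notin> ?K" using cell_cycle_flip_notin(1)[OF cyc k(2)] by simp
      then have "grid_point r (center m) \<notin> inside (tangle_of r ?K)"
        using free[of k] used[OF k(2)] W k(1) 2 by simp
      then show ?thesis using \<sigma> k(2) par 2 unfolding inside_parity_def
        by (metis vertex_parity_flip(1))
    qed
  qed
  then show "cell_cycle (xs @ shear z)"
    unfolding cell_cycle_shear_iff using cyc by (metis (no_types, lifting) image_iff list.set_map)
qed

lemma cell_cycle_constructible:
  assumes r: "r > 0"
  shows "cell_cycle ks \<Longrightarrow> inside_parity r ks \<sigma> \<Longrightarrow> constructible r (tangle_of r (set ks))"
proof (induction "card (verts_inside r (tangle_of r (set ks)))" arbitrary: ks rule: less_induct)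
  case less
  note cyc = less.prems(1) and \<sigma> = less.prems(2)
  have fin: "finite (verts_inside r (tangle_of r (set ls)))" if "cell_cycle ls" for ls
    using finite_subset[OF _ finite_pts_inside[OF r jordanD(7)[OF cell_cycle_square_tangle(2)[OF r that]]]]
    by (auto simp: verts_inside_def)
  have IH: "constructible r (tangle_of r (set ls))"
    if ls: "cell_cycle ls" "inside_parity r ls \<sigma>"
      "verts_inside r (tangle_of r (set ls)) \<subseteq> verts_inside r (tangle_of r (set ks))"
      "grid_point r (center w) \<in> inside (tangle_of r (set ks))"
        "grid_point r (center w) \<notin> inside (tangle_of r (set ls))" for ls w
  proof (rule less.hyps[OF _ ls(1,2)])
    have "center w \<in> verts_inside r (tangle_of r (set ks)) - verts_inside r (tangle_of r (set ls))"
      using ls(4,5) by (auto simp: verts_inside_def)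
    then show "card (verts_inside r (tangle_of r (set ls))) < card (verts_inside r (tangle_of r (set ks)))"
      using ls(3) fin[OF cyc] by (intro psubset_card_mono) auto
  qed
  \<comment> \<open>Parity other than \<open>\<sigma>\<close> means concave: there is no concave
    link, or one without its opposite, or all of them are paired.\<close>
  consider (circle) "\<And>k. k \<in> set ks \<Longrightarrow> vertex_parity (center k) = \<sigma>"
    | (single) z where "z \<in> set ks" "vertex_parity (center z) \<noteq> \<sigma>" "opposite z \<notin> set ks"
    | (mates) D where "D \<in> set ks" "vertex_parity (center D) \<noteq> \<sigma>"
        "\<And>k. k \<in> set ks \<Longrightarrow> vertex_parity (center k) \<noteq> \<sigma> \<Longrightarrow> opposite k \<in> set ks"
    by metis
  then show ?case
  proof cases
    case circle
    have "grid_point r (center (hd ks)) \<in> tiling_vertices r"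
      by (cases "hd ks") (auto simp: tiling_vertices_def grid_point_def center.simps)
    moreover have "tangle_of r (set ks) = sphere (grid_point r (center (hd ks))) r"
      using cell_cycle_convex_circle[OF cyc circle]
        tangle_of_center_eq_sphere[OF r, of "hd ks"] by simp
    ultimately show ?thesis
      unfolding constructible_def using cell_cycle_square_tangle(1)[OF r cyc]
      by (intro exI[of _ "0::nat"] exI[of _ "\<lambda>_. tangle_of r (set ks)"]) auto
  next
    case single
    obtain as bs where "ks = as @ z # bs" using single(1) by (meson split_list)
    then obtain xs where xs: "cell_cycle (xs @ [z])" "set ks = set (xs @ [z])"
      using cyc cell_cycle_rotate[of "as @ [z]" bs] by (intro that[of "bs @ as"]) auto
    have \<sigma>1: "inside_parity r (xs @ [z]) \<sigma>" using \<sigma> xs(2) by (simp add: inside_parity_def)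
    have opposite: "opposite z \<notin> set (xs @ [z])" using single(3) xs(2) by simp
    note new = shear_open[OF r xs(1) \<sigma>1 single(2) opposite]
    \<comment> \<open>A single link does not close up; \<open>hd xs\<close> serves as the link
      common to both curves.\<close>
    have "xs \<noteq> []" using xs(1) by (auto simp: cell_cycle_def)
    then have hd: "hd xs \<in> set xs" by simp
    note J = cell_cycle_square_tangle(2)[OF r xs(1)]
    have tile_center: "grid_point r (tile_center z) \<in> inside (tangle_of r (set (xs @ [z])))"
      using tangle_of_used_cell[OF r J, of z] \<sigma>1 single(2) by (auto simp: inside_parity_def)
    have in_flip: "grid_point r (center (src_flip z)) \<in> inside (tangle_of r (set (xs @ [z])))"
      "grid_point r (center (tgt_flip z)) \<in> inside (tangle_of r (set (xs @ [z])))"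
      using cell_cycle_flip_notin[OF xs(1), of z] tangle_of_free_cell[OF r J, of "src_flip z"]
        tangle_of_free_cell[OF r J, of "tgt_flip z"] tile_center by auto
    have "grid_point r (center l) \<in> inside (tangle_of r (set (xs @ [z])))"
      if "l \<in> set (xs @ shear z)" "l \<notin> set (xs @ [z])" for l
      using that in_flip new(2) by (auto simp: shear_def)
    from cell_cycle_grow[OF r xs(1) new(1) \<sigma>1 this, of "hd xs"] hd
    have grow: "inside_parity r (xs @ shear z) \<sigma>"
      "verts_inside r (tangle_of r (set (xs @ shear z))) \<subseteq> verts_inside r (tangle_of r (set (xs @ [z])))"
      by auto
    have n: "turn (opposite z) \<in> set (xs @ shear z)" by (simp add: shear_def)
    \<comment> \<open>The new curve runs around this vertex, whose parity is not
      \<open>\<sigma>\<close>, so it is no longer enclosed; this makes the measure drop.\<close>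
    have "grid_point r (center (opposite z)) \<notin> inside (tangle_of r (set (xs @ shear z)))"
      using bspec[OF grow(1)[unfolded inside_parity_def] n] single(2) by simp
    then have "constructible r (tangle_of r (set (xs @ shear z)))"
      using IH[OF new(1) grow(1)] grow(2) new(2) unfolding xs(2) by blast
    then show ?thesis
      using constructible_step cell_cycle_square_tangle(1)[OF r xs(1)]
        shear_step(2)[OF r xs(1) new(1) \<sigma>1 grow(1) single(2)] unfolding xs(2) by blast
  next
    case mates
    have ex: "\<exists>f. sides (set ls) f" if "cell_cycle ls" for ls
      using tangle_of_sides[OF r cell_cycle_square_tangle(2)[OF r that]] by blast
    obtain xs z where xs: "cell_cycle (xs @ shear z)" "set (xs @ shear z) = set ks"
      "vertex_parity (center z) = \<sigma>"
      by (rule leaf_exists[OF ex cyc mates(1), of \<sigma>]) (use mates in auto)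
    have \<sigma>2: "inside_parity r (xs @ shear z) \<sigma>" using \<sigma> xs(2) by (simp add: inside_parity_def)
    have cyc1: "cell_cycle (xs @ [z])" and notin: "opposite z \<notin> set (xs @ [z])"
      using xs(1) unfolding cell_cycle_shear_iff by force+
    have "xs \<noteq> []" using cyc1 by (auto simp: cell_cycle_def)
    then have hd: "hd xs \<in> set xs" by simp
    note J = cell_cycle_square_tangle(2)[OF r xs(1)] and J1 = cell_cycle_square_tangle(2)[OF r cyc1]
    have shear: "src_flip z \<in> set (xs @ shear z)" "turn (opposite z) \<in> set (xs @ shear z)" by
      (simp_all add: shear_def)
    have "z \<notin> set (xs @ shear z)"
      using cell_cycle_flip_notin(1)[OF xs(1) shear(1)] by simp
    \<comment> \<open>\<open>src_flip z\<close> is concave, which puts the tile center inside, and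
      the free link \<open>z\<close> does not separate it from \<open>center z\<close>.\<close>
    then have zin: "grid_point r (center z) \<in> inside (tangle_of r (set (xs @ shear z)))"
      using tangle_of_free_cell[OF r J, of z] tangle_of_used_cell[OF r J shear(1)]
        bspec[OF \<sigma>2[unfolded inside_parity_def] shear(1)] xs(3) by auto
    have "grid_point r (center l) \<in> inside (tangle_of r (set (xs @ shear z)))"
      if "l \<in> set (xs @ [z])" "l \<notin> set (xs @ shear z)" for l
      using that zin by auto
    from cell_cycle_grow[OF r xs(1) cyc1 \<sigma>2 this, of "hd xs"] hd
    have grow: "inside_parity r (xs @ [z]) \<sigma>"
      "verts_inside r (tangle_of r (set (xs @ [z]))) \<subseteq> verts_inside r (tangle_of r (set (xs @ shear z)))"
      by auto
    have "grid_point r (center (opposite z)) \<in> inside (tangle_of r (set (xs @ shear z)))"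
      using bspec[OF \<sigma>2[unfolded inside_parity_def] shear(2)] xs(3) by simp
    \<comment> \<open>Without the detour this vertex is on the side of the tile center, which is
      outside because \<open>z\<close> is convex.\<close>
    moreover have "grid_point r (center (opposite z)) \<notin> inside (tangle_of r (set (xs @ [z])))"
      using tangle_of_free_cell[OF r J1 notin] tangle_of_used_cell[OF r J1, of z] grow(1) xs(3)
      by (auto simp: inside_parity_def)
    ultimately have "constructible r (tangle_of r (set (xs @ [z])))"
      using IH[OF cyc1 grow(1)] grow(2) unfolding xs(2) by blast
    then show ?thesis
      using constructible_step cell_cycle_square_tangle(1)[OF r xs(1)]
        shear_step(1)[OF r cyc1 xs(1) grow(1) \<sigma>2 xs(3)] unfolding xs(2) by blast
  qed
qed

theorem theorem3p2:
  fixes r :: real and T :: "complex set"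
  assumes "r > 0" and "square_tangle r T"
  shows "constructible r T"
proof -
  obtain ks where ks: "cell_cycle ks" "T = tangle_of r (set ks)"
    using square_tangle_cell_cycle[OF assms] .
  obtain \<sigma> where "inside_parity r ks \<sigma>" using inside_parity_exists[OF assms(1) ks(1)] .
  then show ?thesis using cell_cycle_constructible[OF assms(1) ks(1)] ks(2) by simp
qed

end
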